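(* Let $\mathcal{G}$ be a connected signed, colored graph of type $(n+1,n+1)$ satisfying axioms (ax1)–(ax5), such that each connected component of the $(n,n)$-restriction of $\mathcal{G}$ is isomorphic to a standard dual equivalence graph $\mathcal{G}_\mu$ for some partition $\mu$ of $n$. Then there exists a morphism from $\mathcal{G}$ to $\mathcal{G}_\lambda$ for a unique partition $\lambda$ of $n+1$.
   Context: Tableaux conventions. Partitions, French diagrams (cells $(i,j)$ with $1\le i\le\lambda_j$, rows from bottom). $\mathrm{SYT}(\lambda)$: bijections from cells to $[m]$, $m=|\lambda|$, increasing along rows and up columns. Content of $(i,j)$ is $i-j$; content reading word reads entries by increasing content, each diagonal southwest to northeast; descent signature $\sigma(T)\in\{\pm1\}^{m-1}$, $\sigma(T)_i=+1$ iff $i$ is left of $i+1$ in the reading word. $d_i$ on words: identity if $i$ lies positionally between $i-1,i+1$, otherwise swap $i$ with the farther of $i\pm1$; on tableaux, swap the corresponding entries. $\mathcal{G}_\lambda$: type $(m,m)$ graph on $\mathrm{SYT}(\lambda)$ with descent signatures and $E_i=\{\{T,d_i(T)\}:d_i(T)\ne T\}$, $1<i<m$. A signed, colored graph of type $(n,N)$ is $(V,\sigma,E)$: finite $V$, $\sigma:V\to\{\pm1\}^{N-1}$, for $1<i<n$ sets $E_i$ of $2$-element subsets of $V$. Its $(m,M)$-restriction ($m\le n$, $M\le N$) has vertices $V$, signatures truncated to the first $M-1$ coordinates, and edges $E_2,\dots,E_{m-1}$. Axioms (indices only where defined): (ax1) for $w\in V$, $1<i<n$: $\sigma(w)_{i-1}=-\sigma(w)_i$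 iff some $x$ has $\{w,x\}\in E_i$, and such $x$ is unique; (ax2) if $\{w,x\}\in E_i$: $\sigma(w)_j=-\sigma(x)_j$ for $j=i-1,i$ and $\sigma(w)_h=\sigma(x)_h$ for $h<i-2$, $h>i+1$; (ax3) if $\{w,x\}\in E_i$ and $\sigma(w)_{i-2}=-\sigma(x)_{i-2}$ then $\sigma(w)_{i-2}=-\sigma(w)_{i-1}$; if $\sigma(w)_{i+1}=-\sigma(x)_{i+1}$ then $\sigma(w)_{i+1}=-\sigma(w)_i$; (ax4) each component of $(V,E_{i-1}\cup E_i)$ is a single vertex, a path $x,y,z$ with only edges $\{x,y\}\in E_{i-1}$, $\{y,z\}\in E_i$, or two vertices joined by both an $E_{i-1}$- and an $E_i$-edge; each component of $(V,E_{i-2}\cup E_{i-1}\cup E_i)$ is: (a) a single vertex; (b) a path $p,q,r,s$ with only edges $\{p,q\}\in E_{i-2}$, $\{q,r\}\in E_{i-1}$, $\{r,s\}\in E_i$; (c) vertices $a,b,c,d,e$ with only edges $\{a,b\}\in E_{i-2}\cap E_{i-1}$, $\{b,c\}\in E_i$, $\{c,d\}\in E_{i-2}$, $\{d,e\}\in E_{i-1}\cap E_i$; (d) vertices $u,v,w,x,y,z$ with only edges $\{u,v\}\in E_{i-1}$, $\{v,w\}\in E_{i-2}$, $\{v,x\}\in E_i$, $\{w,y\}\in E_i$, $\{x,y\}\in E_{i-2}$, $\{y,z\}\in E_{i-1}$; (ax5) if $\{w,x\}\in E_i$, $\{x,y\}\in E_j$, $|i-j|\ge3$, then some $v$ has $\{w,v\}\in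 E_j$, $\{v,y\}\in E_i$. A morphism between signed colored graphs of type $(n,N)$ satisfying (ax1) is a vertex map $\phi$ with $\sigma(\phi(v))=\sigma(v)$ and $\{\phi(u),\phi(v)\}\in E_i$ whenever $\{u,v\}\in E_i$; an isomorphism is a bijective morphism. *)

theory Defs
  imports Main
begin

section \<open>Signed, colored graphs\<close>

text \<open>A signed, colored graph: vertex set, signature (coordinates 1..N-1 are
meaningful, values +1/-1), and edge sets E i (meaningful for 1 < i < n).\<close>

record 'v scg =
  verts :: "'v set"
  sig   :: "'v \<Rightarrow> nat \<Rightarrow> int"
  edges :: "nat \<Rightarrow> 'v set set"

definition is_scg :: "nat \<Rightarrow> nat \<Rightarrow> 'v scg \<Rightarrow> bool" where
  "is_scg n N G \<longleftrightarrow>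
     finite (verts G) \<and>
     (\<forall>v\<in>verts G. \<forall>j. 1 \<le> j \<and> j < N \<longrightarrow> sig G v j \<in> {1, -1}) \<and>
     (\<forall>i. 1 < i \<and> i < n \<longrightarrow>
        (\<forall>e\<in>edges G i. \<exists>a b. a \<in> verts G \<and> b \<in> verts G \<and> a \<noteq> b \<and> e = {a, b}))"

text \<open>(m,M)-restriction: truncate signatures to the first M-1 coordinates,
keep only the edges E 2, ..., E (m-1).\<close>
definition scg_restrict :: "nat \<Rightarrow> nat \<Rightarrow> 'v scg \<Rightarrow> 'v scg" where
  "scg_restrict m M G =
     \<lparr> verts = verts G,
       sig = (\<lambda>v j. if 1 \<le> j \<and> j < M then sig G v j else 0),
       edges = (\<lambda>i. if 1 < i \<and> i < m then edges G i else {}) \<rparr>"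

text \<open>Connectivity with respect to the edges of a set of colors.\<close>
definition col_rel :: "'v scg \<Rightarrow> nat set \<Rightarrow> ('v \<times> 'v) set" where
  "col_rel G I = {(u, v). \<exists>i\<in>I. {u, v} \<in> edges G i}"

definition col_comp :: "'v scg \<Rightarrow> nat set \<Rightarrow> 'v \<Rightarrow> 'v set" where
  "col_comp G I v = {u. (v, u) \<in> (col_rel G I)\<^sup>*}"

definition colors :: "nat \<Rightarrow> nat set" where
  "colors n = {i. 1 < i \<and> i < n}"

definition scg_connected :: "nat \<Rightarrow> 'v scg \<Rightarrow> bool" where
  "scg_connected n G \<longleftrightarrow> verts G \<noteq> {} \<and>
     (\<forall>u\<in>verts G. \<forall>v\<in>verts G. (u, v) \<in> (col_rel G (colors n))\<^sup>*)"

text \<open>Connected components of a graph of type (n,N).\<close>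
definition scg_components :: "nat \<Rightarrow> 'v scg \<Rightarrow> 'v set set" where
  "scg_components n G = col_comp G (colors n) ` verts G"

text \<open>The subgraph induced on a vertex set C.\<close>
definition induced_sub :: "'v scg \<Rightarrow> 'v set \<Rightarrow> 'v scg" where
  "induced_sub G C = \<lparr> verts = C, sig = sig G, edges = (\<lambda>i. {e \<in> edges G i. e \<subseteq> C}) \<rparr>"

text \<open>Edges of color k lying inside C.\<close>
definition ecol :: "'v scg \<Rightarrow> 'v set \<Rightarrow> nat \<Rightarrow> 'v set set" where
  "ecol G C k = {e \<in> edges G k. e \<subseteq> C}"

section \<open>Axioms (indices only where defined: signature coordinates 1..N-1,
edge colors 1 < i < n)\<close>

definition sc :: "nat \<Rightarrow> nat \<Rightarrow> bool" where
  "sc N j \<longleftrightarrow> 1 \<le> j \<and> j < N"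

definition ax1 :: "nat \<Rightarrow> nat \<Rightarrow> 'v scg \<Rightarrow> bool" where
  "ax1 n N G \<longleftrightarrow> (\<forall>w\<in>verts G. \<forall>i. 1 < i \<and> i < n \<longrightarrow>
     ((sc N (i - 1) \<and> sc N i) \<longrightarrow>
        (sig G w (i - 1) = - sig G w i \<longleftrightarrow> (\<exists>x. {w, x} \<in> edges G i))) \<and>
     (\<forall>x y. {w, x} \<in> edges G i \<longrightarrow> {w, y} \<in> edges G i \<longrightarrow> x = y))"

definition ax2 :: "nat \<Rightarrow> nat \<Rightarrow> 'v scg \<Rightarrow> bool" where
  "ax2 n N G \<longleftrightarrow> (\<forall>i w x. 1 < i \<and> i < n \<longrightarrow> {w, x} \<in> edges G i \<longrightarrow>
     (\<forall>j\<in>{i - 1, i}. sc N j \<longrightarrow> sig G w j = - sig G x j) \<and>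
     (\<forall>h. sc N h \<and> (h + 2 < i \<or> h > i + 1) \<longrightarrow> sig G w h = sig G x h))"

definition ax3 :: "nat \<Rightarrow> nat \<Rightarrow> 'v scg \<Rightarrow> bool" where
  "ax3 n N G \<longleftrightarrow> (\<forall>i w x. 1 < i \<and> i < n \<longrightarrow> {w, x} \<in> edges G i \<longrightarrow>
     ((i \<ge> 3 \<and> sc N (i - 2) \<and> sc N (i - 1) \<and> sig G w (i - 2) = - sig G x (i - 2))
        \<longrightarrow> sig G w (i - 2) = - sig G w (i - 1)) \<and>
     ((sc N (i + 1) \<and> sc N i \<and> sig G w (i + 1) = - sig G x (i + 1))
        \<longrightarrow> sig G w (i + 1) = - sig G w i))"

definition ax4 :: "nat \<Rightarrow> nat \<Rightarrow> 'v scg \<Rightarrow> bool" where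
  "ax4 n N G \<longleftrightarrow>
   (\<forall>i. 2 < i \<and> i < n \<longrightarrow> (\<forall>v\<in>verts G. let C = col_comp G {i - 1, i} v in
      C = {v} \<or>
      (\<exists>x y z. distinct [x, y, z] \<and> C = {x, y, z} \<and>
         ecol G C (i - 1) = {{x, y}} \<and> ecol G C i = {{y, z}}) \<or>
      (\<exists>x y. x \<noteq> y \<and> C = {x, y} \<and>
         ecol G C (i - 1) = {{x, y}} \<and> ecol G C i = {{x, y}}))) \<and>
   (\<forall>i. 3 < i \<and> i < n \<longrightarrow> (\<forall>v\<in>verts G. let C = col_comp G {i - 2, i - 1, i} v in
      C = {v} \<or>
      (\<exists>p q r s. distinct [p, q, r, s] \<and> C = {p, q, r, s} \<and>
         ecol G C (i - 2) = {{p, q}} \<and> ecol G C (i - 1) = {{q, r}} \<and>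
         ecol G C i = {{r, s}}) \<or>
      (\<exists>a b c d e. distinct [a, b, c, d, e] \<and> C = {a, b, c, d, e} \<and>
         ecol G C (i - 2) = {{a, b}, {c, d}} \<and> ecol G C (i - 1) = {{a, b}, {d, e}} \<and>
         ecol G C i = {{b, c}, {d, e}}) \<or>
      (\<exists>u v' w x y z. distinct [u, v', w, x, y, z] \<and> C = {u, v', w, x, y, z} \<and>
         ecol G C (i - 1) = {{u, v'}, {y, z}} \<and> ecol G C (i - 2) = {{v', w}, {x, y}} \<and>
         ecol G C i = {{v', x}, {w, y}})))"

definition ax5 :: "nat \<Rightarrow> nat \<Rightarrow> 'v scg \<Rightarrow> bool" where
  "ax5 n N G \<longleftrightarrow> (\<forall>i j w x y. 1 < i \<and> i < n \<and> 1 < j \<and> j < n \<longrightarrow>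
     {w, x} \<in> edges G i \<longrightarrow> {x, y} \<in> edges G j \<longrightarrow> (i + 3 \<le> j \<or> j + 3 \<le> i) \<longrightarrow>
     (\<exists>v. {w, v} \<in> edges G j \<and> {v, y} \<in> edges G i))"

definition scg_axioms :: "nat \<Rightarrow> nat \<Rightarrow> 'v scg \<Rightarrow> bool" where
  "scg_axioms n N G \<longleftrightarrow> ax1 n N G \<and> ax2 n N G \<and> ax3 n N G \<and> ax4 n N G \<and> ax5 n N G"

section \<open>Morphisms\<close>

definition scg_morphism :: "nat \<Rightarrow> nat \<Rightarrow> 'v scg \<Rightarrow> 'w scg \<Rightarrow> ('v \<Rightarrow> 'w) \<Rightarrow> bool" where
  "scg_morphism n N G H \<phi> \<longleftrightarrow>
     (\<forall>v\<in>verts G. \<phi> v \<in> verts H) \<and>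
     (\<forall>v\<in>verts G. \<forall>j. sc N j \<longrightarrow> sig H (\<phi> v) j = sig G v j) \<and>
     (\<forall>i u v. 1 < i \<and> i < n \<longrightarrow> {u, v} \<in> edges G i \<longrightarrow> {\<phi> u, \<phi> v} \<in> edges H i)"

definition scg_iso :: "nat \<Rightarrow> nat \<Rightarrow> 'v scg \<Rightarrow> 'w scg \<Rightarrow> ('v \<Rightarrow> 'w) \<Rightarrow> bool" where
  "scg_iso n N G H \<phi> \<longleftrightarrow> scg_morphism n N G H \<phi> \<and> bij_betw \<phi> (verts G) (verts H)"

section \<open>Partitions, standard Young tableaux, standard dual equivalence graphs\<close>

text \<open>A partition is a weakly decreasing list of positive parts; lambda ! (j-1)
is the length of row j (rows counted from the bottom, French convention).\<close>
definition partition_of :: "nat \<Rightarrow> nat list \<Rightarrow> bool" where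
  "partition_of m lam \<longleftrightarrow> sorted_wrt (\<ge>) lam \<and> (\<forall>x\<in>set lam. 0 < x) \<and> sum_list lam = m"

text \<open>Cells (i,j): column i, row j, 1 \<le> i \<le> lambda_j.\<close>
definition cells :: "nat list \<Rightarrow> (nat \<times> nat) set" where
  "cells lam = {(i, j). 1 \<le> j \<and> j \<le> length lam \<and> 1 \<le> i \<and> i \<le> lam ! (j - 1)}"

type_synonym tableau = "nat \<times> nat \<Rightarrow> nat"

text \<open>Standard Young tableaux; entries outside the diagram are normalised to 0.\<close>
definition SYT :: "nat list \<Rightarrow> tableau set" where
  "SYT lam = {T. bij_betw T (cells lam) {1..sum_list lam} \<and>
     (\<forall>c. c \<notin> cells lam \<longrightarrow> T c = 0) \<and>
     (\<forall>i j. (i, j) \<in> cells lam \<and> (i + 1, j) \<in> cells lam \<longrightarrow> T (i, j) < T (i + 1, j)) \<and>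
     (\<forall>i j. (i, j) \<in> cells lam \<and> (i, j + 1) \<in> cells lam \<longrightarrow> T (i, j) < T (i, j + 1))}"

definition content :: "nat \<times> nat \<Rightarrow> int" where
  "content c = int (fst c) - int (snd c)"

text \<open>Order of cells in the content reading word: increasing content, each
diagonal read southwest to northeast (increasing row index).\<close>
definition rw_less :: "nat \<times> nat \<Rightarrow> nat \<times> nat \<Rightarrow> bool" where
  "rw_less c d \<longleftrightarrow> content c < content d \<or> (content c = content d \<and> snd c < snd d)"

definition rwpos :: "nat list \<Rightarrow> nat \<times> nat \<Rightarrow> nat" where
  "rwpos lam c = card {d \<in> cells lam. rw_less d c}"

definition cell_of :: "nat list \<Rightarrow> tableau \<Rightarrow> nat \<Rightarrow> nat \<times> nat" where
  "cell_of lam T k = (THE c. c \<in> cells lam \<and> T c = k)"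

text \<open>Position of the entry k in the content reading word of T.\<close>
definition epos :: "nat list \<Rightarrow> tableau \<Rightarrow> nat \<Rightarrow> int" where
  "epos lam T k = int (rwpos lam (cell_of lam T k))"

definition dsig :: "nat list \<Rightarrow> tableau \<Rightarrow> nat \<Rightarrow> int" where
  "dsig lam T i = (if epos lam T i < epos lam T (i + 1) then 1 else -1)"

definition swap_entries :: "tableau \<Rightarrow> nat \<Rightarrow> nat \<Rightarrow> tableau" where
  "swap_entries T a b = (\<lambda>c. if T c = a then b else if T c = b then a else T c)"

text \<open>The elementary dual equivalence d_i.\<close>
definition dop :: "nat list \<Rightarrow> nat \<Rightarrow> tableau \<Rightarrow> tableau" where
  "dop lam i T =
     (let p = epos lam T (i - 1); q = epos lam T i; r = epos lam T (i + 1) in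
      if (p < q \<and> q < r) \<or> (r < q \<and> q < p) then T
      else if \<bar>p - q\<bar> > \<bar>r - q\<bar> then swap_entries T i (i - 1)
      else swap_entries T i (i + 1))"

text \<open>The standard dual equivalence graph G_lambda, of type (m,m), m = |lambda|.\<close>
definition Gstd :: "nat list \<Rightarrow> tableau scg" where
  "Gstd lam = \<lparr> verts = SYT lam, sig = dsig lam,
     edges = (\<lambda>i. if 1 < i \<and> i < sum_list lam
                  then {{T, dop lam i T} | T. T \<in> SYT lam \<and> dop lam i T \<noteq> T} else {}) \<rparr>"

end

theory Submission
  imports Defs
begin

text \<open>Tableaux are replaced by their content vectors, on which the elementary dual equivalences act by
  transpositions of neighbouring letters. Each component of the restriction is a full set of content
  vectors of a partition \<open>\<mu>\<close>; axioms 2 and 3 make the last signature coordinate a threshold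
  function of the position of \<open>n\<close>, which picks out one addable cell of \<open>\<mu>\<close> for \<open>n + 1\<close>. It remains
  to identify the edges of color \<open>n\<close>. By axiom 5 and rigidity the two ends of such an edge agree on
  the entries up to \<open>n - 2\<close>, and these may be rearranged at will. Placing \<open>n - 2\<close> and \<open>n - 3\<close> on suitable
  removable cells, which exist because between two addable contents there is a removable one and
  conversely, the two- and three-color components of axiom 4 leave only the dual equivalence.\<close>

text \<open>Contents suffice because entries at distance at most two never lie on the same diagonal:
  between the cells \<open>(i, j)\<close> and \<open>(i + 1, j + 1)\<close> a standard filling must
  place two further entries. So every comparison of positions made by \<open>dsig\<close> and
  \<open>dop\<close> is a comparison of contents.

  The obstacle is that an edge of color \<open>n\<close> may lead to a component with another \<mu>,
  where the cell of \<open>n + 1\<close> was chosen independently. A common \<lambda> becomes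
  visible only once these edges are understood, because then connectivity propagates the shape. All
  that is known of such an edge beforehand is its effect on signatures and its interplay with edges
  of other colors.

  Rigidity means that a content word is determined by its signature together with the signatures of
  all words that dual moves produce from it. The same principle, applied to the images of one vertex
  under two morphisms, gives the uniqueness of \<lambda>.\<close>

section \<open>Content words\<close>

text \<open>A partition is encoded by its Maya diagram, the set of bead positions
  \<open>\<lambda>\<^sub>j - j + 1\<close> for \<open>j \<ge> 1\<close>: adding a cell of content \<open>c\<close> moves the bead at \<open>c\<close> to \<open>c + 1\<close>.\<close>

definition addable :: "int set \<Rightarrow> int \<Rightarrow> bool" where
  "addable M c \<longleftrightarrow> c \<in> M \<and> c + 1 \<notin> M"

definition removable :: "int set \<Rightarrow> int \<Rightarrow> bool" where
  "removable M c \<longleftrightarrow> c \<notin> M \<and> c + 1 \<in> M"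

definition add_cell :: "int set \<Rightarrow> int \<Rightarrow> int set" where
  "add_cell M c = insert (c + 1) (M - {c})"

definition remove_cell :: "int set \<Rightarrow> int \<Rightarrow> int set" where
  "remove_cell M c = insert c (M - {c + 1})"

lemmas maya_defs = addable_def removable_def add_cell_def remove_cell_def

text \<open>A standard tableau is encoded by the list of the contents of its entries in decreasing order, so
  that the head belongs to the largest entry.\<close>

fun shape :: "int list \<Rightarrow> int set" where
  "shape [] = {..0}"
| "shape (c # w) = add_cell (shape w) c"

fun cword :: "int list \<Rightarrow> bool" where
  "cword [] = True"
| "cword (c # w) \<longleftrightarrow> cword w \<and> addable (shape w) c"

text \<open>Letters are indexed from the end of the list, so a letter put in front leaves the
  earlier coordinates alone. Ties do not arise, since neighbouring letters of a \<open>cword\<close>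
  differ.\<close>

fun word_sig :: "int list \<Rightarrow> nat \<Rightarrow> int" where
  "word_sig (x # y # r) i = (if length r + 1 = i then (if y < x then 1 else -1) else word_sig (y # r) i)"
| "word_sig w i = 0"

text \<open>At the active position \<open>x\<close>, \<open>y\<close>, \<open>z\<close> belong to
  the entries \<open>i + 1\<close>, \<open>i\<close>, \<open>i - 1\<close>. The neighbour of
  \<open>i\<close> farther away in the reading word is the one with the other neighbour in
  between.\<close>

fun word_dual :: "nat \<Rightarrow> int list \<Rightarrow> int list" where
  "word_dual i (x # y # z # r) =
     (if length r + 2 = i then
        (if (z < y \<and> y < x) \<or> (x < y \<and> y < z) then x # y # z # r
         else if (y < x \<and> x < z) \<or> (z < x \<and> x < y) then x # z # y # r
         else y # x # z # r)
      else x # word_dual i (y # z # r))"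
| "word_dual i w = w"

section \<open>Interlacing of addable and removable contents\<close>

text \<open>A discrete intermediate value principle: on the way from a bead to a gap some step
  leaves \<open>M\<close>.\<close>

lemma int_switch_up:
  fixes a b :: int
  assumes "a \<le> b" "a \<in> M" "b \<notin> M"
  shows "\<exists>c. a \<le> c \<and> c < b \<and> addable M c"
proof -
  have "\<exists>c. a \<le> c \<and> c < a + int k \<and> addable M c" if "a + int k \<notin> M" for k
    using that
  proof (induction k)
    case 0 then show ?case using assms by simp
  next
    case (Suc k)
    show ?case
    proof (cases "a + int k \<in> M")
      case True
      then show ?thesis using Suc.prems
        by (intro exI[of _ "a + int k"]) (auto simp: addable_def algebra_simps)
    next
      case False
      from Suc.IH[OF this] show ?thesis by force
    qed
  qed
  from this[of "nat (b - a)"] show ?thesis using assms by auto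
qed

lemma int_switch_down:
  fixes a b :: int
  assumes "a \<le> b" "a \<notin> M" "b \<in> M"
  shows "\<exists>c. a \<le> c \<and> c < b \<and> removable M c"
  using int_switch_up[of a b "- M"] assms by (auto simp: addable_def removable_def)

definition strictly_between :: "int \<Rightarrow> int \<Rightarrow> int \<Rightarrow> bool" where
  "strictly_between a c b \<longleftrightarrow> (a < c \<and> c < b) \<or> (b < c \<and> c < a)"

text \<open>For \<open>a < b\<close>, there is a gap at \<open>a + 1\<close> and a bead at
  \<open>b\<close>, so the diagram switches from gap to bead in between.\<close>

lemma removable_between_addable:
  assumes "addable M a" "addable M b" "a \<noteq> b"
  shows "\<exists>g. removable M g \<and> strictly_between a g b"
proof -
  have *: "\<exists>g. removable M g \<and> a < g \<and> g < b" if "addable M a" "addable M b" "a < b" for a b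
    using int_switch_down[of "a + 1" b M] that by (auto simp: addable_def)
  show ?thesis
    using *[of a b] *[of b a] assms by (auto simp: strictly_between_def neq_iff)
qed

lemma removable_gap:
  assumes "removable M a" "removable M b" "a \<noteq> b"
  shows "\<bar>a - b\<bar> \<ge> 2"
proof -
  have "b \<noteq> a + 1" "a \<noteq> b + 1" using assms by (auto simp: removable_def)
  then show ?thesis using assms(3) by linarith
qed

text \<open>For \<open>a < b\<close>, taking off both cells leaves a gap at \<open>a + 1\<close> and
  a bead at \<open>b\<close>, so a corner appears strictly in between. The entry placed there turns
  the exchange of \<open>a\<close> and \<open>b\<close> into a dual move.\<close>

lemma removable_between_removable:
  assumes "removable M a" "removable M b" "a \<noteq> b"
  shows "\<exists>e. removable (remove_cell (remove_cell M a) b) e \<and> strictly_between a e b"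
proof -
  have *: "\<exists>e. removable (remove_cell (remove_cell M a) b) e \<and> a < e \<and> e < b"
    if "removable M a" "removable M b" "a < b" for a b
    using int_switch_down[of "a + 1" b "remove_cell (remove_cell M a) b"] that removable_gap[OF that(1,2)]
    by (auto simp: remove_cell_def)
  have comm: "remove_cell (remove_cell M a) b = remove_cell (remove_cell M b) a"
    using removable_gap[OF assms] by (auto simp: remove_cell_def)
  show ?thesis
    using *[of a b] *[of b a] comm assms by (auto simp: strictly_between_def neq_iff)
qed

lemma remove_add_cell: "addable M c \<Longrightarrow> remove_cell (add_cell M c) c = M"
  by (auto simp: maya_defs)

lemma removable_add_cell: "addable M c \<Longrightarrow> removable (add_cell M c) c"
  by (auto simp: maya_defs)

lemma removable_far: "\<bar>a - b\<bar> \<ge> 2 \<Longrightarrow> removable (remove_cell M a) b \<longleftrightarrow> removable M b"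
  by (auto simp: maya_defs)

lemma addable_far: "\<bar>a - b\<bar> \<ge> 2 \<Longrightarrow> addable (add_cell M a) b \<longleftrightarrow> addable M b"
  by (auto simp: maya_defs)

lemma add_cell_commute: "\<bar>a - b\<bar> \<ge> 2 \<Longrightarrow> add_cell (add_cell M a) b = add_cell (add_cell M b) a"
  by (auto simp: maya_defs)

lemma cword_hd_removable: "cword (c # w) \<Longrightarrow> removable (shape (c # w)) c"
  by (simp add: removable_add_cell)

section \<open>Exchanges of letters, dual moves and signatures\<close>

lemma cword_distinct2: "cword (x # y # r) \<Longrightarrow> x \<noteq> y"
  by (auto simp: maya_defs)

lemma cword_distinct3: "cword (x # y # z # r) \<Longrightarrow> x \<noteq> z"
  by (auto simp: maya_defs)

text \<open>Cells whose contents differ by at least two are not adjacent, so neither has to be added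
  before the other.\<close>

lemma cword_swap:
  assumes "cword (x # y # r)" "\<bar>x - y\<bar> \<ge> 2"
  shows "cword (y # x # r)" "shape (y # x # r) = shape (x # y # r)"
  using assms addable_far[of x y "shape r"] addable_far[of y x "shape r"]
  by (auto simp: add_cell_commute abs_minus_commute)

lemma strictly_between_gap: "strictly_between a c b \<Longrightarrow> \<bar>a - b\<bar> \<ge> 2"
  by (auto simp: strictly_between_def)

lemma length_word_dual [simp]: "length (word_dual i w) = length w"
  by (induction i w rule: word_dual.induct) auto

lemma word_dual_Cons: "i < length w \<Longrightarrow> word_dual i (x # w) = x # word_dual i w"
  by (cases "(i, x # w)" rule: word_dual.cases) auto

lemma word_sig_Cons: "i < length w \<Longrightarrow> word_sig (x # w) i = word_sig w i"
  by (cases w) auto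

text \<open>In each nontrivial case the third letter lies between the two exchanged ones. These
  therefore differ by at least two, and \<open>cword_swap\<close> applies.\<close>

lemma cword_word_dual:
  "cword w \<Longrightarrow> cword (word_dual i w) \<and> shape (word_dual i w) = shape w"
proof (induction i w rule: word_dual.induct)
  case (1 i x y z r)
  show ?case
  proof (cases "length r + 2 = i")
    case True
    have d: "x \<noteq> y" "y \<noteq> z" "x \<noteq> z"
      using cword_distinct2[of x y "z # r"] cword_distinct3[of x y z r] cword_distinct2[of y z r] 1(2) by auto
    consider "strictly_between z y x" | "strictly_between y x z" | "strictly_between x z y"
      using d unfolding strictly_between_def by linarith
    then show ?thesis
    proof cases
      case 1 then show ?thesis using \<open>cword (x # y # z # r)\<close> True by (auto simp: strictly_between_def)
    next
      case 2
      then have e: "word_dual i (x # y # z # r) = x # z # y # r" 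
        using True by (auto simp: strictly_between_def)
      have "cword (z # y # r)" "shape (z # y # r) = shape (y # z # r)"
        using cword_swap[of y z r] \<open>cword (x # y # z # r)\<close> strictly_between_gap[OF 2] by auto
      with \<open>cword (x # y # z # r)\<close> show ?thesis unfolding e by (metis cword.simps(2) shape.simps(2))
    next
      case 3
      then have e: "word_dual i (x # y # z # r) = y # x # z # r" 
        using True by (auto simp: strictly_between_def)
      show ?thesis
        unfolding e using cword_swap[of x y "z # r"] \<open>cword (x # y # z # r)\<close> strictly_between_gap[OF 3] by blast
    qed
  next
    case False
    with 1 show ?thesis by auto
  qed
qed auto

lemma word_dual_short: "length w \<le> i \<Longrightarrow> word_dual i w = w"
  by (induction i w rule: word_dual.induct) auto

lemma word_dual_involution: "cword w \<Longrightarrow> word_dual i (word_dual i w) = w"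
proof (induction i w rule: word_dual.induct)
  case (1 i x y z r)
  have d: "x \<noteq> y" "y \<noteq> z" "x \<noteq> z"
    using cword_distinct2[of x y "z # r"] cword_distinct3[of x y z r] cword_distinct2[of y z r] 1(2) by auto
  show ?case
  proof (cases "length r + 2 = i")
    case True with d show ?thesis by auto
  next
    case False
    show ?thesis
    proof (cases "i < length (y # z # r)")
      case True
      then show ?thesis using 1 False by (simp add: word_dual_Cons del: word_dual.simps cword.simps(2)) simp
    next
      case F: False
      then show ?thesis using False by (simp add: word_dual_short del: word_dual.simps)
    qed
  qed
qed auto

lemma word_sig_range: "1 \<le> i \<Longrightarrow> i < length w \<Longrightarrow> word_sig w i \<in> {1, -1}"
  by (induction w i rule: word_sig.induct) auto

text \<open>The middle letter lies between its neighbours exactly when both comparisons go the same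
  way. This is the counterpart of the first axiom on words.\<close>

lemma word_dual_fixed_iff:
  "cword w \<Longrightarrow> 1 < i \<Longrightarrow> i < length w \<Longrightarrow>
     word_dual i w = w \<longleftrightarrow> word_sig w (i - 1) = word_sig w i"
proof (induction i w rule: word_dual.induct)
  case (1 i x y z r)
  have d: "x \<noteq> y" "y \<noteq> z" "x \<noteq> z"
    using cword_distinct2[of x y "z # r"] cword_distinct3[of x y z r] cword_distinct2[of y z r] 1(2) by auto
  show ?case
  proof (cases "length r + 2 = i")
    case True
    with d show ?thesis by auto
  next
    case False
    then have "i < length (y # z # r)" using 1 by simp
    then have "word_sig (x # y # z # r) (i - 1) = word_sig (y # z # r) (i - 1)"
      "word_sig (x # y # z # r) i = word_sig (y # z # r) i"
      by (auto intro: word_sig_Cons simp del: word_sig.simps)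
    then show ?thesis using 1 False \<open>i < length (y # z # r)\<close>
      by (simp del: word_sig.simps)
  qed
qed auto

section \<open>Connectivity and rigidity of the words of one shape\<close>

text \<open>Any corner may carry the largest entry. If another corner \<open>c\<close> does, then
  \<open>a\<close> is still a corner without \<open>c\<close>; by induction \<open>a\<close> comes
  second, and the two letters commute because corners are at least two apart.\<close>

lemma cword_removable:
  "cword w \<Longrightarrow> removable (shape w) a \<Longrightarrow>
     \<exists>p. cword (a # p) \<and> length (a # p) = length w \<and> shape (a # p) = shape w"
proof (induction w arbitrary: a)
  case Nil
  then show ?case by (auto simp: removable_def)
next
  case (Cons c w)
  show ?case
  proof (cases "c = a")
    case True then show ?thesis using Cons.prems by blast
  next
    case False
    have gap: "\<bar>c - a\<bar> \<ge> 2"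
      using removable_gap[OF cword_hd_removable[OF Cons.prems(1)] Cons.prems(2) False] .
    have sh: "shape w = remove_cell (shape (c # w)) c"
      using Cons.prems(1) by (simp add: remove_add_cell)
    have "removable (shape w) a"
      unfolding sh using removable_far[OF gap] Cons.prems(2) by blast
    then obtain p where p: "cword (a # p)" "length (a # p) = length w" "shape (a # p) = shape w"
      using Cons.IH Cons.prems(1) by auto
    then have "cword (c # a # p)" "shape (c # a # p) = shape (c # w)" using Cons.prems(1) by auto
    with p(2) cword_swap[OF this(1) gap] show ?thesis
      by (intro exI[of _ "c # p"]) auto
  qed
qed

lemma shape_tl: "cword (a # p) \<Longrightarrow> shape p = remove_cell (shape (a # p)) a"
  by (simp add: remove_add_cell)

lemma word_dual_top_between:
  assumes "strictly_between x z y"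
  shows "word_dual (length r + 2) (x # y # z # r) = y # x # z # r"
  using assms by (auto simp: strictly_between_def)

lemma cword_two_removable:
  assumes w: "cword w" and ab: "removable (shape w) a" "removable (shape w) b" "a \<noteq> b"
  shows "\<exists>e r. strictly_between a e b \<and> cword (a # b # e # r) \<and>
           length (a # b # e # r) = length w \<and> shape (a # b # e # r) = shape w"
proof -
  have gap: "\<bar>a - b\<bar> \<ge> 2" using removable_gap ab by blast
  obtain p where p: "cword (a # p)" "length (a # p) = length w" "shape (a # p) = shape w"
    using cword_removable[OF w ab(1)] by auto
  have rb: "removable (shape p) b"
    unfolding shape_tl[OF p(1)] p(3) removable_far[OF gap] by (rule ab(2))
  then obtain q where q: "cword (b # q)" "length (b # q) = length p" "shape (b # q) = shape p"
    using cword_removable[OF _ rb] p(1) by (metis cword.simps(2))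
  have sq: "shape q = remove_cell (remove_cell (shape w) a) b"
    unfolding shape_tl[OF q(1)] q(3) unfolding shape_tl[OF p(1)] p(3) ..
  obtain e where e: "removable (shape q) e" "strictly_between a e b"
    using removable_between_removable[OF ab] unfolding sq by blast
  obtain r where r: "cword (e # r)" "length (e # r) = length q" "shape (e # r) = shape q"
    using cword_removable[OF _ e(1)] q(1) by auto
  have "cword (a # b # e # r)" "shape (a # b # e # r) = shape w"
    using p q r by auto
  then show ?thesis using e p(2) q(2) r(2) by (intro exI[of _ e] exI[of _ r]) auto
qed

text \<open>The standard tableaux of one shape form a single dual equivalence class. Words with the
  same head are joined by induction on their tails; for heads \<open>a\<close> and \<open>b\<close>
  the path goes through \<open>a # b # e # r\<close> with \<open>e\<close> in between, where the top
  move exchanges the heads.\<close>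

lemma word_dual_connected [consumes 4, case_names start step]:
  assumes "cword u" "cword w" "length u = length w" "shape u = shape w"
    and "P u"
    and "\<And>v i. P v \<Longrightarrow> cword v \<Longrightarrow> length v = length w \<Longrightarrow> 1 < i \<Longrightarrow> i < length w
           \<Longrightarrow> P (word_dual i v)"
  shows "P w"
  using assms
proof (induction "length w" arbitrary: u w P)
  case 0
  then show ?case by simp
next
  case (Suc n)
  obtain b q where w: "w = b # q" using Suc.hyps(2) by (cases w) auto
  have same_hd: "P (a # q')"
    if "P (a # p')" "cword (a # p')" "cword (a # q')" "length (a # p') = length w"
      "length (a # q') = length w" "shape (a # p') = shape (a # q')" for a p' q'
  proof -
    have "shape p' = shape q'" using that shape_tl by metis
    moreover have "P (a # word_dual i v)"
      if "P (a # v)" "cword v" "length v = length q'" "1 < i" "i < length q'"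
        "shape v = shape q'" for v i
    proof -
      have "cword (a # v)" using \<open>cword (a # q')\<close> that by simp
      then show ?thesis
        using Suc.prems(6)[OF \<open>P (a # v)\<close>, of i] that \<open>length (a # q') = length w\<close>
        by (simp add: word_dual_Cons)
    qed
    \<comment> \<open>The induction rule does not hand on the shape of the intermediate words, which
      decides whether \<open>a\<close> may still be put in front; hence it is made part of the
      predicate.\<close>
    ultimately have "P (a # q') \<and> shape q' = shape q'"
      using that Suc.hyps cword_word_dual
      by (intro Suc.hyps(1)[of q' p' "\<lambda>v. P (a # v) \<and> shape v = shape q'"]) auto
    then show ?thesis by simp
  qed
  obtain a p where u: "u = a # p" using Suc.hyps(2) Suc.prems(3) by (cases u) auto
  show ?case
  proof (cases "a = b")
    case True
    then show ?thesis using same_hd[of b p q] Suc.prems u w by simp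
  next
    case False
    obtain e r where er: "strictly_between a e b" "cword (a # b # e # r)"
           "length (a # b # e # r) = length w" "shape (a # b # e # r) = shape w"
      using cword_two_removable[OF Suc.prems(2), of a b] cword_hd_removable Suc.prems(1,2,4) u w False
      by metis
    have "P (a # b # e # r)"
      using same_hd[of a p "b # e # r"] Suc.prems(1-5) er u by simp
    then have "P (word_dual (length r + 2) (a # b # e # r))"
      by (rule Suc.prems(6)[OF _ er(2,3)]) (simp_all add: er(3)[symmetric])
    then have P: "P (b # a # e # r)"
      using word_dual_top_between er(1) by simp
    have "cword (b # a # e # r)" "shape (b # a # e # r) = shape w"
      using cword_swap[OF er(2) strictly_between_gap[OF er(1)]] er(4) by auto
    then show ?thesis
      using same_hd[OF P, of q] Suc.prems(2) er w by simp
  qed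
qed

lemma cword_addable_removable:
  assumes "cword w" "addable (shape w) a" "addable (shape w) b" "a \<noteq> b"
  shows "\<exists>g r. strictly_between a g b \<and> cword (g # r) \<and> length (g # r) = length w
           \<and> shape (g # r) = shape w"
  using removable_between_addable[OF assms(2-4)] cword_removable[OF assms(1)] by blast

text \<open>Two different cells added to the same shape are told apart by the signature once the preceding
  entry has been moved to a removable cell between them.\<close>

lemma bisimilar_words_equal:
  assumes "\<And>p q. R p q \<Longrightarrow> cword p \<and> cword q \<and> length p = n \<and> length q = n"
    and "\<And>p q i. R p q \<Longrightarrow> 1 \<le> i \<Longrightarrow> i < n \<Longrightarrow> word_sig p i = word_sig q i"
    and "\<And>p q i. R p q \<Longrightarrow> 1 < i \<Longrightarrow> i < n \<Longrightarrow> R (word_dual i p) (word_dual i q)"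
    and "R p q"
  shows "p = q"
  using assms
proof (induction n arbitrary: R p q)
  case 0
  then show ?case by (metis length_0_conv)
next
  case (Suc n)
  \<comment> \<open>Tails of related words are again related in the required way: coordinates and
    moves of index below \<open>n\<close> do not see the heads.\<close>
  let ?R = "\<lambda>p q. \<exists>x y. R (x # p) (y # q)"
  have tl_eq: "p' = q'" if "?R p' q'" for p' q'
  proof (rule Suc.IH[of ?R, OF _ _ _ that])
    fix p q assume "?R p q"
    then obtain x y where xy: "R (x # p) (y # q)" by blast
    show len: "cword p \<and> cword q \<and> length p = n \<and> length q = n"
      using Suc.prems(1)[OF xy] by simp
    show "word_sig p i = word_sig q i" if "1 \<le> i" "i < n" for i
      using Suc.prems(2)[OF xy, of i] that len by (simp add: word_sig_Cons)
    show "?R (word_dual i p) (word_dual i q)" if "1 < i" "i < n" for i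
      using Suc.prems(3)[OF xy, of i] that len by (auto simp: word_dual_Cons)
  qed
  obtain x p' y q' where pq: "p = x # p'" "q = y # q'"
    using Suc.prems(1)[OF Suc.prems(4)] by (cases p; cases q) auto
  have eq: "p' = q'" using tl_eq Suc.prems(4) pq by blast
  have c: "cword (x # p')" "cword (y # p')" "length p' = n"
    using Suc.prems(1)[OF Suc.prems(4)] pq eq by auto
  show ?case
  proof (rule ccontr)
    assume "p \<noteq> q"
    then have "x \<noteq> y" using pq eq by simp
    then obtain g r where g: "strictly_between x g y" "cword (g # r)" "length (g # r) = length p'"
        "shape (g # r) = shape p'"
      using cword_addable_removable[of p' x y] c by auto
    \<comment> \<open>The common tail is moved to one that starts with \<open>g\<close>. Moves of
      color below \<open>n\<close> leave both heads in place.\<close>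
    have "cword p'" using c by simp
    from this g(2) g(3)[symmetric] g(4)[symmetric] have "R (x # g # r) (y # g # r)"
    proof (induction rule: word_dual_connected)
      case start
      show ?case using Suc.prems(4) pq eq by simp
    next
      case (step v i)
      then show ?case using Suc.prems(3)[of "x # v" "y # v" i] c g(3)
        by (simp add: word_dual_Cons)
    qed
    \<comment> \<open>Coordinate \<open>n\<close> compares the head with \<open>g\<close>, and the
      two heads lie on different sides of \<open>g\<close>.\<close>
    from Suc.prems(2)[OF this, of n] g c show False
      by (auto simp: strictly_between_def split: if_splits)
  qed
qed

section \<open>Choosing the cell of the new largest entry\<close>

lemma shape_lower: "\<exists>L. \<forall>k\<le>L. k \<in> shape w"
proof (induction w)
  case Nil then show ?case by auto
next
  case (Cons c w)
  then obtain L where "\<forall>k\<le>L. k \<in> shape w" by blast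
  then show ?case by (intro exI[of _ "min L (c - 1)"]) (auto simp: add_cell_def)
qed

lemma shape_upper: "\<exists>U. \<forall>k\<ge>U. k \<notin> shape w"
proof (induction w)
  case Nil then show ?case by (intro exI[of _ 1]) auto
next
  case (Cons c w)
  then obtain U where "\<forall>k\<ge>U. k \<notin> shape w" by blast
  then show ?case by (intro exI[of _ "max U (c + 2)"]) (auto simp: add_cell_def)
qed

text \<open>The last corner \<open>a\<close> with \<open>P\<close> has a bead at
  \<open>a + 1\<close>, and the first corner without \<open>P\<close> is a gap. A switch from bead
  to gap between them is the addable content sought.\<close>

lemma addable_separates:
  assumes "\<And>a b. removable (shape w) a \<Longrightarrow> removable (shape w) b \<Longrightarrow> P b \<Longrightarrow> a < b \<Longrightarrow> P a"
  shows "\<exists>c. addable (shape w) c \<and> (\<forall>a. removable (shape w) a \<longrightarrow> (P a \<longleftrightarrow> a < c))"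
proof -
  obtain L U where L: "\<forall>k\<le>L. k \<in> shape w" and U: "\<forall>k\<ge>U. k \<notin> shape w"
    using shape_lower shape_upper by blast
  have LU: "L < U"
    using L[rule_format, of U] U[rule_format, of U] by (cases "U \<le> L") auto
  have rng: "L \<le> a \<and> a < U" if "removable (shape w) a" for a
  proof -
    have "\<not> a \<le> L" "\<not> a + 1 \<ge> U" using that L U by (auto simp: removable_def)
    then show ?thesis by simp
  qed
  have fin: "finite {a. removable (shape w) a}"
    by (rule finite_subset[of _ "{L..U}"]) (use rng in force)+
  \<comment> \<open>\<open>L\<close> and \<open>U\<close> serve as sentinels in case one class of
    corners is empty: all elements of \<open>X\<close> are beads and all elements of
    \<open>Y\<close> are gaps.\<close>
  define X where "X = insert L ((\<lambda>a. a + 1) ` {a. removable (shape w) a \<and> P a})"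
  define Y where "Y = insert U {a. removable (shape w) a \<and> \<not> P a}"
  have finX: "finite X" "X \<noteq> {}" and finY: "finite Y" "Y \<noteq> {}"
    using fin unfolding X_def Y_def by auto
  have "x \<le> y" if "x \<in> X" "y \<in> Y" for x y
  proof -
    have "a < b" if "removable (shape w) a" "P a" "removable (shape w) b" "\<not> P b" for a b
      using assms[OF that(3,1)] that by (metis linorder_neqE_linordered_idom)
    then show ?thesis using that rng LU unfolding X_def Y_def by fastforce
  qed
  then have le: "Max X \<le> Min Y" using finX finY by simp
  have "Max X \<in> shape w"
    using Max_in[OF finX] L unfolding X_def by (auto simp: removable_def)
  moreover have "Min Y \<notin> shape w"
    using Min_in[OF finY] U unfolding Y_def by (auto simp: removable_def)
  ultimately obtain c where c: "Max X \<le> c" "c < Min Y" "addable (shape w) c"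
    using int_switch_up[OF le] by blast
  have "P a \<longleftrightarrow> a < c" if "removable (shape w) a" for a
  proof
    assume "P a"
    then have "a + 1 \<in> X" using that X_def by auto
    then have "a + 1 \<le> Max X" using finX by simp
    then show "a < c" using c by simp
  next
    assume "a < c"
    show "P a"
    proof (rule ccontr)
      assume "\<not> P a"
      then have "a \<in> Y" using that Y_def by auto
      then have "Min Y \<le> a" using finY by simp
      then show False using c \<open>a < c\<close> by simp
    qed
  qed
  with c show ?thesis by blast
qed

text \<open>The hypotheses are what the axioms say about the last coordinate of the signature on a component
  of lower color; the conclusion provides the cell of the new largest entry.\<close>

lemma sign_extension:
  fixes \<tau> :: "int list \<Rightarrow> int"
  assumes w0: "cword w0" "length w0 = n" "0 < n"
    and rng: "\<And>w. cword w \<Longrightarrow> length w = n \<Longrightarrow> shape w = shape w0 \<Longrightarrow> \<tau> w \<in> {1, -1}"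
    and low: "\<And>w i. cword w \<Longrightarrow> length w = n \<Longrightarrow> shape w = shape w0 \<Longrightarrow> 1 < i \<Longrightarrow> i + 1 < n
            \<Longrightarrow> \<tau> (word_dual i w) = \<tau> w"
    and top: "\<And>w. cword w \<Longrightarrow> length w = n \<Longrightarrow> shape w = shape w0 \<Longrightarrow> 2 < n
            \<Longrightarrow> word_dual (n - 1) w \<noteq> w \<Longrightarrow> \<tau> (word_dual (n - 1) w) \<noteq> \<tau> w
            \<Longrightarrow> \<tau> w \<noteq> word_sig w (n - 1)"
  shows "\<exists>c. addable (shape w0) c \<and>
           (\<forall>a p. cword (a # p) \<longrightarrow> length (a # p) = n \<longrightarrow> shape (a # p) = shape w0 \<longrightarrow>
              (\<tau> (a # p) = 1 \<longleftrightarrow> a < c))"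
proof -
  let ?W = "\<lambda>w. cword w \<and> length w = n \<and> shape w = shape w0"
  \<comment> \<open>Words with head \<open>a\<close> are connected by moves on the tail. These have
    color below \<open>n - 1\<close>, so \<open>low\<close> applies to each.\<close>
  have hd_only: "\<tau> (a # p) = \<tau> (a # q)" if "?W (a # p)" "?W (a # q)" for a p q
  proof -
    have "cword p" "cword q" "length p = length q" "shape p = shape q"
      using that shape_tl[of a p] shape_tl[of a q] by auto
    then have "shape q = shape p \<and> \<tau> (a # q) = \<tau> (a # p)"
    proof (induction rule: word_dual_connected)
      case start
      then show ?case by simp
    next
      case (step v i)
      have W: "?W (a # v)" using step that by auto
      have "\<tau> (word_dual i (a # v)) = \<tau> (a # v)"
        using low[of "a # v" i] W step that by auto
      then show ?case
        using step cword_word_dual[of v i] that by (simp add: word_dual_Cons)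
    qed
    then show ?thesis by simp
  qed
  define P where "P a \<longleftrightarrow> (\<exists>p. ?W (a # p) \<and> \<tau> (a # p) = 1)" for a
  \<comment> \<open>If the sign were +1 at \<open>b\<close> and -1 at \<open>a < b\<close>, the top
    move on \<open>b # a # e # r\<close> would change \<tau>. Then \<open>top\<close> forbids \<tau>
    to equal coordinate \<open>n - 1\<close> there, yet both are +1.\<close>
  have "P a" if ab: "removable (shape w0) a" "removable (shape w0) b" "a < b" and "P b" for a b
  proof (rule ccontr)
    assume "\<not> P a"
    obtain e r where er: "strictly_between b e a" "cword (b # a # e # r)"
      "length (b # a # e # r) = length w0" "shape (b # a # e # r) = shape w0"
      using cword_two_removable[OF w0(1) ab(2,1)] ab(3) by auto
    let ?w = "b # a # e # r"
    have W: "?W ?w" using er w0 by simp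
    have n: "n = length r + 3" using er w0 by simp
    have dual: "word_dual (n - 1) ?w = a # b # e # r"
      using word_dual_top_between[OF er(1), of r] n by (simp add: add.commute)
    have W': "?W (a # b # e # r)"
      using cword_swap[OF er(2) strictly_between_gap[OF er(1)]] W by auto
    have "\<tau> ?w = 1" using \<open>P b\<close> hd_only W unfolding P_def by metis
    moreover have "\<tau> (a # b # e # r) \<noteq> 1" using \<open>\<not> P a\<close> W' unfolding P_def by blast
    ultimately have "\<tau> ?w \<noteq> word_sig ?w (n - 1)"
      using top[of ?w] W dual n ab(3) by simp
    then show False using \<open>\<tau> ?w = 1\<close> n ab(3) by simp
  qed
  then obtain c where c: "addable (shape w0) c" "\<And>a. removable (shape w0) a \<Longrightarrow> P a \<longleftrightarrow> a < c"
    using addable_separates[of w0 P] by blast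
  have "\<tau> (a # p) = 1 \<longleftrightarrow> a < c" if "?W (a # p)" for a p
  proof -
    have "P a \<longleftrightarrow> \<tau> (a # p) = 1" using that hd_only unfolding P_def by metis
    then show ?thesis using c(2)[of a] cword_hd_removable[of a p] that by metis
  qed
  with c(1) show ?thesis by blast
qed

section \<open>Content words of standard tableaux\<close>

text \<open>Padding with empty rows lets lengthening a row and starting a new one be the same
  function update.\<close>

definition row_len :: "nat list \<Rightarrow> nat \<Rightarrow> nat" where
  "row_len lam j = (if 1 \<le> j \<and> j \<le> length lam then lam ! (j - 1) else 0)"

definition decreasing_rows :: "(nat \<Rightarrow> nat) \<Rightarrow> bool" where
  "decreasing_rows r \<longleftrightarrow> (\<forall>j\<ge>1. r (Suc j) \<le> r j)"

text \<open>The bead of row \<open>j\<close> sits at the content of the first cell beyond that row,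
  which is the cell whose addition moves it.\<close>

definition maya :: "(nat \<Rightarrow> nat) \<Rightarrow> int set" where
  "maya r = {int (r j) + 1 - int j | j. 1 \<le> j}"

section \<open>Row lengths, beads and diagrams\<close>

lemma decreasing_rowsD:
  assumes "decreasing_rows r" "1 \<le> j" "j \<le> k"
  shows "r k \<le> r j"
  using assms(3)
proof (induction k rule: dec_induct)
  case base then show ?case by simp
next
  case (step k)
  then have "r (Suc k) \<le> r k" using assms by (simp add: decreasing_rows_def)
  with step show ?case by simp
qed

lemma bead_less:
  assumes "decreasing_rows r" "1 \<le> j" "j < k"
  shows "int (r k) + 1 - int k < int (r j) + 1 - int j"
  using decreasing_rowsD[OF assms(1,2), of k] assms(3) by simp

lemma bead_inj:
  assumes "decreasing_rows r" "1 \<le> j" "1 \<le> k" "int (r k) + 1 - int k = int (r j) + 1 - int j"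
  shows "j = k"
  using bead_less[OF assms(1)] assms(2-4) by (metis less_irrefl linorder_neqE_nat)

text \<open>Beads of decreasing rows have strictly decreasing positions. For the enlarged rows this
  says that the target of the moving bead is not taken by a lower row.\<close>

lemma maya_add_cell:
  assumes r: "decreasing_rows r" "decreasing_rows (r(j := Suc (r j)))" and j: "1 \<le> j"
  shows "addable (maya r) (int (r j) + 1 - int j)"
    and "maya (r(j := Suc (r j))) = add_cell (maya r) (int (r j) + 1 - int j)"
proof -
  have notin: "int (r j) + 1 - int j + 1 \<noteq> int (r k) + 1 - int k" if "1 \<le> k" for k
  proof (cases "k < j")
    case True
    from bead_less[OF r(2) that this] True show ?thesis by simp
  next
    case False
    with decreasing_rowsD[OF r(1) j, of k] show ?thesis by simp
  qed
  show "addable (maya r) (int (r j) + 1 - int j)"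
    unfolding addable_def maya_def using j notin by blast
  have "maya (r(j := Suc (r j))) =
      insert (int (r j) + 1 - int j + 1) {int (r k) + 1 - int k | k. 1 \<le> k \<and> k \<noteq> j}"
    unfolding maya_def using j by (auto; force)
  moreover have "{int (r k) + 1 - int k | k. 1 \<le> k \<and> k \<noteq> j} = maya r - {int (r j) + 1 - int j}"
    unfolding maya_def using bead_inj[OF r(1)] j by blast
  ultimately show "maya (r(j := Suc (r j))) = add_cell (maya r) (int (r j) + 1 - int j)"
    by (simp add: add_cell_def)
qed

text \<open>If row \<open>j\<close> were as long as row \<open>j - 1\<close>, the bead of row
  \<open>j - 1\<close> would occupy \<open>c + 1\<close>.\<close>

lemma maya_addableD:
  assumes r: "decreasing_rows r" and "addable (maya r) c"
  shows "\<exists>j\<ge>1. c = int (r j) + 1 - int j \<and> (j = 1 \<or> r j < r (j - 1))"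
proof -
  obtain j where j: "1 \<le> j" "c = int (r j) + 1 - int j"
    using assms(2) unfolding addable_def maya_def by auto
  have "r j < r (j - 1)" if "j \<noteq> 1"
  proof (rule ccontr)
    assume "\<not> r j < r (j - 1)"
    then have "r j = r (j - 1)" using decreasing_rowsD[OF r, of "j - 1" j] that j(1) by simp
    then have "c + 1 = int (r (j - 1)) + 1 - int (j - 1)" using j that by simp
    then have "c + 1 \<in> maya r" unfolding maya_def using that j(1) by fastforce
    then show False using assms(2) by (simp add: addable_def)
  qed
  with j show ?thesis by blast
qed

lemma cells_row_len: "(i, j) \<in> cells lam \<longleftrightarrow> 1 \<le> j \<and> 1 \<le> i \<and> i \<le> row_len lam j"
  unfolding cells_def row_len_def by auto

lemma decreasing_row_len:
  assumes "partition_of m lam"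
  shows "decreasing_rows (row_len lam)"
proof -
  have "lam ! (Suc i) \<le> lam ! i" if "Suc i < length lam" for i
    using assms that unfolding partition_of_def sorted_wrt_iff_nth_less by simp
  then have "row_len lam (Suc (Suc i)) \<le> row_len lam (Suc i)" for i
    unfolding row_len_def by auto
  then show ?thesis
    unfolding decreasing_rows_def by (metis Suc_le_D One_nat_def)
qed

lemma cells_inj:
  assumes "partition_of m lam" "partition_of m' lam'" "cells lam = cells lam'"
  shows "lam = lam'"
proof -
  have rows: "row_len lam j = row_len lam' j" for j
  proof (cases "1 \<le> j")
    case True
    then have "{i. 1 \<le> i \<and> i \<le> row_len lam j} = {i. 1 \<le> i \<and> i \<le> row_len lam' j}"
      using assms(3) cells_row_len by blast
    then have "{1..row_len lam j} = {1..row_len lam' j}" by (simp add: atLeastAtMost_def atLeast_def atMost_def Collect_conj_eq)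
    then show ?thesis by (metis card_atLeastAtMost diff_Suc_1 One_nat_def)
  qed (simp add: row_len_def)
  have pos: "0 < row_len lam j \<longleftrightarrow> 1 \<le> j \<and> j \<le> length lam" if "partition_of m lam" for m lam j
    using that unfolding partition_of_def row_len_def by auto
  have eq: "1 \<le> j \<and> j \<le> length lam \<longleftrightarrow> 1 \<le> j \<and> j \<le> length lam'" for j
    using pos[OF assms(1), of j] pos[OF assms(2), of j] rows[of j] by simp
  have "length lam = length lam'"
    using eq[of "length lam"] eq[of "length lam'"] by (cases "length lam"; cases "length lam'") auto
  moreover have "lam ! i = lam' ! i" if "i < length lam" for i
    using rows[of "Suc i"] that \<open>length lam = length lam'\<close> by (simp add: row_len_def)
  ultimately show ?thesis by (rule nth_equalityI)
qed

lemma initial_segment: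
  fixes A :: "nat set"
  assumes fin: "finite A" and down: "\<And>i i'. i' \<in> A \<Longrightarrow> 1 \<le> i \<Longrightarrow> i \<le> i' \<Longrightarrow> i \<in> A"
    and "0 \<notin> A"
  shows "A = {1..card A}"
proof (cases "A = {}")
  case False
  obtain k where k: "k \<in> A" "\<And>i. i \<in> A \<Longrightarrow> i \<le> k"
    using Max_in[OF fin False] Max_ge[OF fin] by blast
  have "1 \<le> i" if "i \<in> A" for i using that assms(3) by (cases i) auto
  then have "A \<subseteq> {1..k}" using k(2) unfolding subset_iff atLeastAtMost_iff by blast
  moreover have "{1..k} \<subseteq> A" using down[OF k(1)] unfolding subset_iff atLeastAtMost_iff by blast
  ultimately have A: "A = {1..k}" by blast
  then have "card A = k" by simp
  with A show ?thesis by simp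
qed simp

lemma finite_cells: "finite (cells lam)"
proof -
  have "cells lam \<subseteq> (\<Union>j\<in>{..length lam}. {..row_len lam j} \<times> {j})"
    unfolding cells_def row_len_def by auto
  then show ?thesis using finite_subset by blast
qed

section \<open>The word of a standard tableau\<close>

fun rev_word :: "(nat \<Rightarrow> int) \<Rightarrow> nat \<Rightarrow> int list" where
  "rev_word c 0 = []"
| "rev_word c (Suc k) = c (Suc k) # rev_word c k"

definition tab_word :: "nat list \<Rightarrow> tableau \<Rightarrow> nat \<Rightarrow> int list" where
  "tab_word lam T = rev_word (\<lambda>k. content (cell_of lam T k))"

lemma length_rev_word [simp]: "length (rev_word c k) = k"
  by (induction k) auto

lemma rev_word_cong: "(\<And>k. 1 \<le> k \<Longrightarrow> k \<le> m \<Longrightarrow> c k = c' k) \<Longrightarrow> rev_word c m = rev_word c' m"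
  by (induction m) auto

lemma rev_word_eqD: "rev_word c m = rev_word c' m \<Longrightarrow> 1 \<le> k \<Longrightarrow> k \<le> m \<Longrightarrow> c k = c' k"
  by (induction m) (auto simp: le_Suc_eq)

lemma word_sig_rev_word:
  "1 \<le> i \<Longrightarrow> i < m \<Longrightarrow> word_sig (rev_word c m) i = (if c i < c (Suc i) then 1 else -1)"
proof (induction m)
  case 0 then show ?case by simp
next
  case (Suc m)
  then obtain k where k: "m = Suc k" by (cases m) auto
  show ?case
  proof (cases "i = m")
    case True then show ?thesis by (simp add: k)
  next
    case False
    then have "i < length (rev_word c m)" using Suc.prems by simp
    then show ?thesis using Suc False by (simp add: word_sig_Cons)
  qed
qed

text \<open>States the move as a transposition of entries instead of list positions, to be matched
  with \<open>swap_entries\<close>.\<close>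

lemma word_dual_rev_word:
  "1 < i \<Longrightarrow> i < m \<Longrightarrow> word_dual i (rev_word c m) =
     rev_word (if strictly_between (c (i - 1)) (c i) (c (Suc i)) then c
       else if strictly_between (c i) (c (Suc i)) (c (i - 1)) then c(i := c (i - 1), i - 1 := c i)
       else c(i := c (Suc i), Suc i := c i)) m" (is "_ \<Longrightarrow> _ \<Longrightarrow> _ = rev_word ?c m")
proof (induction m)
  case 0 then show ?case by simp
next
  case (Suc m)
  show ?case
  proof (cases "i = m")
    case True
    have "m = Suc (Suc (m - 2))" using Suc.prems True by arith
    then obtain k where k: "m = Suc (Suc k)" ..
    have "rev_word ?c k = rev_word c k"
      by (rule rev_word_cong) (auto simp: True k)
    then show ?thesis unfolding True k by (auto simp: strictly_between_def)
  next
    case False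
    then have "i < m" using Suc.prems by simp
    moreover have "?c (Suc m) = c (Suc m)" using \<open>i < m\<close> by auto
    ultimately show ?thesis using Suc by (simp add: word_dual_Cons)
  qed
qed

lemma SYT_outside: "T \<in> SYT lam \<Longrightarrow> c \<notin> cells lam \<Longrightarrow> T c = 0"
  unfolding SYT_def mem_Collect_eq by blast

context
  fixes lam :: "nat list" and T :: tableau and m :: nat
  assumes lam: "partition_of m lam" and T: "T \<in> SYT lam"
begin

lemma SYT_bij: "bij_betw T (cells lam) {1..m}"
  using T lam unfolding SYT_def partition_of_def by auto

lemma cell_of_eq: "c \<in> cells lam \<Longrightarrow> cell_of lam T (T c) = c"
  unfolding cell_of_def using SYT_bij unfolding bij_betw_def inj_on_def by blast

lemma cell_of_props:
  assumes "1 \<le> k" "k \<le> m"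
  shows "cell_of lam T k \<in> cells lam" "T (cell_of lam T k) = k"
proof -
  have "k \<in> T ` cells lam" using SYT_bij assms unfolding bij_betw_def by simp
  then obtain c where "c \<in> cells lam" "T c = k" by blast
  then show "cell_of lam T k \<in> cells lam" "T (cell_of lam T k) = k"
    using cell_of_eq[of c] by simp_all
qed

lemma SYT_range: "c \<in> cells lam \<Longrightarrow> 1 \<le> T c \<and> T c \<le> m"
  using SYT_bij unfolding bij_betw_def by auto

lemma SYT_row_less: "(i, j) \<in> cells lam \<Longrightarrow> (i', j) \<in> cells lam \<Longrightarrow> i < i' \<Longrightarrow> T (i, j) < T (i', j)"
proof (induction i' rule: less_induct)
  case (less i')
  then obtain l where l: "i' = Suc l" "i \<le> l" by (metis Suc_leI Suc_pred less_imp_Suc_add le_add1 add_Suc_right less_Suc_eq_le)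
  then have c: "(l, j) \<in> cells lam" using less.prems by (auto simp: cells_row_len)
  then have "T (l, j) < T (i', j)" using T less.prems l unfolding SYT_def by auto
  then show ?case using less.IH[of l] c less.prems l by (cases "i = l") auto
qed

text \<open>These are the shapes of the chain of partitions that the tableau encodes.\<close>

definition row_count :: "nat \<Rightarrow> nat \<Rightarrow> nat" where
  "row_count k j = card {i. (i, j) \<in> cells lam \<and> T (i, j) \<le> k}"

lemma row_segment: "{i. (i, j) \<in> cells lam \<and> T (i, j) \<le> k} = {1..row_count k j}"
proof -
  let ?A = "{i. (i, j) \<in> cells lam \<and> T (i, j) \<le> k}"
  have fin: "finite ?A"
    by (rule finite_subset[OF _ finite_imageI[OF finite_cells[of lam], of fst]]) force
  have down: "i \<in> ?A" if "i' \<in> ?A" "1 \<le> i" "i \<le> i'" for i i'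
    using that SYT_row_less[of i j i'] by (cases "i = i'") (auto simp: cells_row_len)
  have zero: "0 \<notin> ?A" by (simp add: cells_row_len)
  show ?thesis
    unfolding row_count_def by (rule initial_segment[OF fin _ zero]) (rule down)
qed

lemma decreasing_row_count: "decreasing_rows (row_count k)"
  unfolding decreasing_rows_def
proof (intro allI impI)
  fix j :: nat assume j: "1 \<le> j"
  have "{1..row_count k (Suc j)} \<subseteq> {1..row_count k j}"
    unfolding row_segment[symmetric]
  proof safe
    fix i assume c: "(i, Suc j) \<in> cells lam" and "T (i, Suc j) \<le> k"
    have "(i, j) \<in> cells lam"
      using c j decreasing_rowsD[OF decreasing_row_len[OF lam] j, of "Suc j"] by (simp add: cells_row_len)
    moreover from this have "T (i, j) < T (i, Suc j)" using T c unfolding SYT_def by simp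
    ultimately show "(i, j) \<in> cells lam" "T (i, j) \<le> k" using \<open>T (i, Suc j) \<le> k\<close> by auto
  qed
  then show "row_count k (Suc j) \<le> row_count k j" by (cases "row_count k (Suc j) = 0") auto
qed

lemma row_count_0: "row_count 0 = (\<lambda>_. 0)"
proof
  fix j
  have none: "{i. (i, j) \<in> cells lam \<and> T (i, j) \<le> 0} = {}" using SYT_range by fastforce
  show "row_count 0 j = 0" unfolding row_count_def none by simp
qed

lemma row_count_Suc:
  assumes "k < m"
  shows "\<exists>j\<ge>1. cell_of lam T (Suc k) = (Suc (row_count k j), j) \<and>
           row_count (Suc k) = (row_count k)(j := Suc (row_count k j))"
proof -
  obtain i j where ij: "cell_of lam T (Suc k) = (i, j)" by fastforce
  then have c: "(i, j) \<in> cells lam" "T (i, j) = Suc k"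
    using cell_of_props[of "Suc k"] assms by auto
  have only: "T c = Suc k \<Longrightarrow> c \<in> cells lam \<Longrightarrow> c = (i, j)" for c
    using cell_of_eq[of c] ij by simp
  have "{1..row_count (Suc k) j} = insert i {1..row_count k j}"
    unfolding row_segment[symmetric] using c only by (auto simp: le_Suc_eq)
  moreover have "i \<notin> {1..row_count k j}"
    unfolding row_segment[symmetric] using c by auto
  ultimately have "row_count (Suc k) j = Suc (row_count k j)"
    using card_insert_disjoint[of "{1..row_count k j}" i] by (metis card_atLeastAtMost diff_Suc_1 finite_atLeastAtMost)
  moreover from this have "i = Suc (row_count k j)"
    using \<open>{1..row_count (Suc k) j} = insert i {1..row_count k j}\<close> \<open>i \<notin> {1..row_count k j}\<close>
    by (metis atLeastAtMost_iff insertI1 le_Suc_eq)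
  moreover have "row_count (Suc k) j' = row_count k j'" if "j' \<noteq> j" for j'
  proof -
    have "{i. (i, j') \<in> cells lam \<and> T (i, j') \<le> Suc k} = {i. (i, j') \<in> cells lam \<and> T (i, j') \<le> k}"
      using only that by (auto simp: le_Suc_eq)
    then show ?thesis unfolding row_count_def by simp
  qed
  moreover have "1 \<le> j" using c(1) by (simp add: cells_row_len)
  ultimately show ?thesis using ij by (intro exI[of _ j]) auto
qed

lemma row_count_full: "1 \<le> j \<Longrightarrow> row_count m j = row_len lam j"
proof -
  assume j: "1 \<le> j"
  have "{i. (i, j) \<in> cells lam \<and> T (i, j) \<le> m} = {1..row_len lam j}"
    using j SYT_range by (auto simp: cells_row_len)
  then show ?thesis unfolding row_count_def by simp
qed

text \<open>Entry \<open>Suc k\<close> occupies the first free cell of some row of the subdiagram of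
  the entries up to \<open>k\<close>, so its content is the position of the bead that moves.\<close>

lemma tab_word_cword:
  "k \<le> m \<Longrightarrow> cword (tab_word lam T k) \<and> shape (tab_word lam T k) = maya (row_count k)"
proof (induction k)
  case 0
  have "x \<in> maya (\<lambda>_. 0)" if "x \<le> 0" for x :: int
    unfolding maya_def using that by (auto intro!: exI[of _ "nat (1 - x)"])
  then have "maya (\<lambda>_. 0) = {..0}" by (auto simp: maya_def)
  then show ?case by (simp add: tab_word_def row_count_0)
next
  case (Suc k)
  then obtain j where j: "1 \<le> j" "cell_of lam T (Suc k) = (Suc (row_count k j), j)"
    "row_count (Suc k) = (row_count k)(j := Suc (row_count k j))"
    using row_count_Suc[of k] by auto
  have ct: "content (cell_of lam T (Suc k)) = int (row_count k j) + 1 - int j"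
    unfolding j(2) content_def by simp
  note add = maya_add_cell[OF decreasing_row_count[of k] _ j(1), folded j(3), OF decreasing_row_count]
  show ?case
    using Suc add ct by (simp add: tab_word_def)
qed

lemma shape_tab_word: "shape (tab_word lam T m) = maya (row_len lam)"
proof -
  have "maya (row_count m) = maya (row_len lam)"
    unfolding maya_def using row_count_full by (metis (no_types, lifting))
  then show ?thesis using tab_word_cword[of m] by simp
qed

lemma rwpos_less:
  assumes "c \<in> cells lam" "rw_less c d"
  shows "rwpos lam c < rwpos lam d"
  unfolding rwpos_def
proof (rule psubset_card_mono)
  show "finite {e \<in> cells lam. rw_less e d}" using finite_cells by simp
  have "c \<in> {e \<in> cells lam. rw_less e d}" "c \<notin> {e \<in> cells lam. rw_less e c}"
    using assms by (auto simp: rw_less_def)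
  moreover have "rw_less e c \<Longrightarrow> rw_less e d" for e
    using assms(2) by (auto simp: rw_less_def)
  ultimately show "{e \<in> cells lam. rw_less e c} \<subset> {e \<in> cells lam. rw_less e d}" by blast
qed

abbreviation entry_content :: "nat \<Rightarrow> int" where
  "entry_content k \<equiv> content (cell_of lam T k)"

lemma epos_less:
  assumes "1 \<le> k" "k \<le> m" "1 \<le> l" "l \<le> m" "entry_content k \<noteq> entry_content l"
  shows "epos lam T k < epos lam T l \<longleftrightarrow> entry_content k < entry_content l"
proof -
  have "epos lam T a < epos lam T b" if "1 \<le> a" "a \<le> m" "entry_content a < entry_content b" for a b
    using rwpos_less[OF cell_of_props(1)[OF that(1,2)], of "cell_of lam T b"] that(3)
    unfolding epos_def by (simp add: rw_less_def)
  from this[of k l] this[of l k] show ?thesis using assms by linarith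
qed

lemma entry_content_distinct:
  assumes "1 \<le> k" "k < m"
  shows "entry_content k \<noteq> entry_content (Suc k)"
    and "Suc k < m \<Longrightarrow> entry_content k \<noteq> entry_content (Suc (Suc k))"
proof -
  obtain l where l: "k = Suc l" using assms by (cases k) auto
  have "cword (tab_word lam T (Suc k))" using tab_word_cword[of "Suc k"] assms by simp
  from cword_distinct2[OF this[unfolded tab_word_def l rev_word.simps]]
  show "entry_content k \<noteq> entry_content (Suc k)" unfolding l by simp
  assume "Suc k < m"
  then have "cword (tab_word lam T (Suc (Suc k)))" using tab_word_cword[of "Suc (Suc k)"] by simp
  from cword_distinct3[OF this[unfolded tab_word_def l rev_word.simps]]
  show "entry_content k \<noteq> entry_content (Suc (Suc k))" unfolding l by simp
qed

lemma word_sig_tab_word: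
  assumes "1 \<le> i" "i < m"
  shows "word_sig (tab_word lam T m) i = dsig lam T i"
  using epos_less[of i "Suc i"] entry_content_distinct(1)[OF assms] assms
  unfolding tab_word_def dsig_def by (simp add: word_sig_rev_word)

text \<open>Exchanging the values \<open>a\<close> and \<open>Suc a\<close> reverses no other
  comparison. Adjacent cells have contents differing by 1, so \<open>far\<close> keeps these two
  values out of adjacent cells.\<close>

lemma swap_entries_cell_of:
  assumes ab: "1 \<le> a" "a < m"
    and far: "\<bar>entry_content a - entry_content (Suc a)\<bar> \<ge> 2"
  shows "swap_entries T a (Suc a) \<in> SYT lam"
proof -
  let ?T = "swap_entries T a (Suc a)"
  let ?\<pi> = "\<lambda>k. if k = a then Suc a else if k = Suc a then a else k"
  have comp: "?T = ?\<pi> \<circ> T" unfolding swap_entries_def by auto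
  have sum: "sum_list lam = m" using lam unfolding partition_of_def by simp
  have "bij_betw ?\<pi> {1..m} {1..m}"
    using ab by (intro bij_betw_byWitness[of _ ?\<pi>]) auto
  then have bij: "bij_betw ?T (cells lam) {1..m}"
    unfolding comp by (rule bij_betw_trans[OF SYT_bij])
  have less: "?T c < ?T d" if "T c < T d" "c \<in> cells lam" "d \<in> cells lam"
    "\<bar>content c - content d\<bar> = 1" for c d
  proof (cases "T c = a \<and> T d = Suc a")
    case True
    then have "c = cell_of lam T a" "d = cell_of lam T (Suc a)"
      using cell_of_eq that by metis+
    then show ?thesis using far that(4) by simp
  next
    case False
    then show ?thesis using that(1) unfolding swap_entries_def by auto
  qed
  have "?T c = 0" if "c \<notin> cells lam" for c
  proof -
    have "T c = 0" using SYT_outside[OF T that] .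
    then show ?thesis using ab unfolding swap_entries_def by simp
  qed
  moreover have "?T (i, j) < ?T (i + 1, j)" if "(i, j) \<in> cells lam" "(i + 1, j) \<in> cells lam" for i j
    using less[of "(i, j)" "(i + 1, j)"] that T unfolding SYT_def content_def by simp
  moreover have "?T (i, j) < ?T (i, j + 1)" if "(i, j) \<in> cells lam" "(i, j + 1) \<in> cells lam" for i j
    using less[of "(i, j)" "(i, j + 1)"] that T unfolding SYT_def content_def by simp
  ultimately show ?thesis using bij unfolding SYT_def sum by blast
qed

end

section \<open>Elementary dual equivalences as moves on words\<close>

lemma cell_of_swap_entries:
  assumes "partition_of m lam" "T \<in> SYT lam" "swap_entries T a (Suc a) \<in> SYT lam" "1 \<le> a" "a < m"
    and k: "1 \<le> k" "k \<le> m"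
  shows "cell_of lam (swap_entries T a (Suc a)) k =
    cell_of lam T (if k = a then Suc a else if k = Suc a then a else k)"
proof -
  let ?k = "if k = a then Suc a else if k = Suc a then a else k"
  let ?c = "cell_of lam T ?k"
  have "1 \<le> ?k" "?k \<le> m" using assms by auto
  then have c: "?c \<in> cells lam" "T ?c = ?k" using cell_of_props[OF assms(1,2)] by blast+
  then have "swap_entries T a (Suc a) ?c = k" unfolding swap_entries_def by (auto split: if_splits)
  then show ?thesis using cell_of_eq[OF assms(1,3) c(1)] by simp
qed

lemma swap_entries_commute: "swap_entries T a b = swap_entries T b a"
  unfolding swap_entries_def by auto

lemma tab_word_swap_entries:
  assumes lam: "partition_of m lam" and T: "T \<in> SYT lam" and a: "1 \<le> a" "a < m"
    and far: "\<bar>content (cell_of lam T a) - content (cell_of lam T (Suc a))\<bar> \<ge> 2"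
  shows "tab_word lam (swap_entries T a (Suc a)) m =
    rev_word ((\<lambda>k. content (cell_of lam T k))(a := content (cell_of lam T (Suc a)),
      Suc a := content (cell_of lam T a))) m"
  unfolding tab_word_def
  using cell_of_swap_entries[OF lam T swap_entries_cell_of[OF lam T a far] a]
  by (intro rev_word_cong) auto

lemma dop_tab_word:
  assumes lam: "partition_of m lam" and T: "T \<in> SYT lam" and i: "1 < i" "i < m"
  shows "dop lam i T \<in> SYT lam" "tab_word lam (dop lam i T) m = word_dual i (tab_word lam T m)"
proof -
  obtain k where k: "i = Suc k" "1 \<le> k" using i by (cases i) auto
  define c where "c = (\<lambda>k. content (cell_of lam T k))"
  have dist: "c k \<noteq> c (Suc k)" "c (Suc k) \<noteq> c (Suc (Suc k))" "c k \<noteq> c (Suc (Suc k))"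
    using entry_content_distinct[OF lam T, of k] entry_content_distinct[OF lam T, of "Suc k"] i k
    unfolding c_def by auto
  define p q r where "p = epos lam T k" "q = epos lam T (Suc k)" "r = epos lam T (Suc (Suc k))"
  have less: "(p < q) = (c k < c (Suc k))" "(q < p) = (c (Suc k) < c k)"
    "(q < r) = (c (Suc k) < c (Suc (Suc k)))" "(r < q) = (c (Suc (Suc k)) < c (Suc k))"
    "(p < r) = (c k < c (Suc (Suc k)))" "(r < p) = (c (Suc (Suc k)) < c k)"
    using epos_less[OF lam T] dist i k unfolding c_def p_q_r_def by auto
  have dop: "dop lam i T = (if strictly_between (c k) (c (Suc k)) (c (Suc (Suc k))) then T
      else if strictly_between (c (Suc k)) (c (Suc (Suc k))) (c k) then swap_entries T k (Suc k)
      else swap_entries T (Suc k) (Suc (Suc k)))"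
  proof -
    have "p < q \<or> q < p" "q < r \<or> r < q" "p < r \<or> r < p"
      unfolding less using dist by linarith+
    \<comment> \<open>When \<open>q\<close> is not between \<open>p\<close> and \<open>r\<close>,
      both lie on the same side of it, so the farther one has the nearer one in between. Distances
      in the reading word thus reduce to the order of contents.\<close>
    then have "\<bar>p - q\<bar> > \<bar>r - q\<bar> \<longleftrightarrow> strictly_between (c (Suc k)) (c (Suc (Suc k))) (c k)"
      if "\<not> strictly_between (c k) (c (Suc k)) (c (Suc (Suc k)))"
      using that unfolding strictly_between_def less[symmetric] by arith
    moreover have "(p < q \<and> q < r) \<or> (r < q \<and> q < p) \<longleftrightarrow> strictly_between (c k) (c (Suc k)) (c (Suc (Suc k)))"
      unfolding strictly_between_def less[symmetric] by blast
    ultimately show ?thesis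
      unfolding dop_def k(1) Let_def using swap_entries_commute[of T k "Suc k"]
      by (simp add: p_q_r_def)
  qed
  have W: "word_dual i (tab_word lam T m) =
     rev_word (if strictly_between (c k) (c (Suc k)) (c (Suc (Suc k))) then c
       else if strictly_between (c (Suc k)) (c (Suc (Suc k))) (c k) then c(Suc k := c k, k := c (Suc k))
       else c(Suc k := c (Suc (Suc k)), Suc (Suc k) := c (Suc k))) m"
    using word_dual_rev_word[OF i, of c] unfolding tab_word_def c_def k by simp
  consider (mid) "strictly_between (c k) (c (Suc k)) (c (Suc (Suc k)))"
    | (low) "\<not> strictly_between (c k) (c (Suc k)) (c (Suc (Suc k)))"
         "strictly_between (c (Suc k)) (c (Suc (Suc k))) (c k)"
    | (high) "\<not> strictly_between (c k) (c (Suc k)) (c (Suc (Suc k)))"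
         "\<not> strictly_between (c (Suc k)) (c (Suc (Suc k))) (c k)" by blast
  then have "dop lam i T \<in> SYT lam \<and> tab_word lam (dop lam i T) m = word_dual i (tab_word lam T m)"
  proof cases
    case mid
    then show ?thesis using T unfolding dop W by (simp add: tab_word_def c_def)
  next
    case low
    have far: "\<bar>content (cell_of lam T k) - content (cell_of lam T (Suc k))\<bar> \<ge> 2"
      using strictly_between_gap[OF low(2)] unfolding c_def by simp
    show ?thesis
      using low swap_entries_cell_of[OF lam T k(2) _ far] tab_word_swap_entries[OF lam T k(2) _ far] i k
      unfolding dop W by (simp add: c_def fun_upd_twist)
  next
    case high
    then have "strictly_between (c (Suc k)) (c k) (c (Suc (Suc k)))"
      using dist unfolding strictly_between_def by linarith
    from strictly_between_gap[OF this]
    have far: "\<bar>content (cell_of lam T (Suc k)) - content (cell_of lam T (Suc (Suc k)))\<bar> \<ge> 2"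
      unfolding c_def by simp
    show ?thesis
      using high swap_entries_cell_of[OF lam T _ _ far] tab_word_swap_entries[OF lam T _ _ far] i k
      unfolding dop W by (simp add: c_def)
  qed
  then show "dop lam i T \<in> SYT lam" "tab_word lam (dop lam i T) m = word_dual i (tab_word lam T m)"
    by auto
qed

text \<open>Rows of one shape have beads at different positions, so the content of the next entry
  tells its row. By induction the words determine all cells, hence also the partition.\<close>

lemma tab_word_inj:
  assumes lam: "partition_of m lam" and T: "T \<in> SYT lam"
    and lam': "partition_of m lam'" and T': "T' \<in> SYT lam'"
    and eq: "tab_word lam T m = tab_word lam' T' m"
  shows "lam = lam'" "T = T'"
proof -
  have content: "content (cell_of lam T k) = content (cell_of lam' T' k)" if "1 \<le> k" "k \<le> m" for k
    using rev_word_eqD eq that unfolding tab_word_def by blast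
  have same: "cell_of lam T (Suc k) = cell_of lam' T' (Suc k) \<and>
      row_count lam T (Suc k) = row_count lam' T' (Suc k)"
    if rc: "row_count lam T k = row_count lam' T' k" and k: "k < m" for k
  proof -
    obtain j where j: "1 \<le> j" "cell_of lam T (Suc k) = (Suc (row_count lam T k j), j)"
           "row_count lam T (Suc k) = (row_count lam T k)(j := Suc (row_count lam T k j))"
      using row_count_Suc[OF lam T k] by blast
    obtain j' where j': "1 \<le> j'" "cell_of lam' T' (Suc k) = (Suc (row_count lam T k j'), j')"
           "row_count lam' T' (Suc k) = (row_count lam T k)(j' := Suc (row_count lam T k j'))"
      using row_count_Suc[OF lam' T' k] rc by auto
    have "int (row_count lam T k j') + 1 - int j' = int (row_count lam T k j) + 1 - int j"
      using content[of "Suc k"] k unfolding j(2) j'(2) content_def by simp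
    then have "j = j'" by (rule bead_inj[OF decreasing_row_count[OF lam T] j(1) j'(1)])
    then show ?thesis using j j' by simp
  qed
  have "row_count lam T k = row_count lam' T' k" if "k \<le> m" for k
    using that
  proof (induction k)
    case 0 then show ?case using row_count_0[OF lam T] row_count_0[OF lam' T'] by simp
  next
    case (Suc k) then show ?case using same by simp
  qed
  then have cell: "cell_of lam T k = cell_of lam' T' k" if "1 \<le> k" "k \<le> m" for k
    using same[of "k - 1"] that by simp
  have cells_sub: "c \<in> cells lam' \<and> T c = T' c" if c: "c \<in> cells lam" for c
  proof -
    have r: "1 \<le> T c" "T c \<le> m" using SYT_range[OF lam T c] by auto
    have "cell_of lam' T' (T c) = c" using cell[OF r] cell_of_eq[OF lam T c] by simp
    then show ?thesis using cell_of_props[OF lam' T' r] by simp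
  qed
  have cells_sup: "c \<in> cells lam" if c: "c \<in> cells lam'" for c
  proof -
    have r: "1 \<le> T' c" "T' c \<le> m" using SYT_range[OF lam' T' c] by auto
    have "cell_of lam T (T' c) = c" using cell[OF r] cell_of_eq[OF lam' T' c] by simp
    then show ?thesis using cell_of_props[OF lam T r] by simp
  qed
  have "cells lam = cells lam'" using cells_sub cells_sup by blast
  then show "lam = lam'" by (rule cells_inj[OF lam lam'])
  show "T = T'"
  proof
    fix c show "T c = T' c"
      using cells_sub[of c] SYT_outside[OF T, of c] SYT_outside[OF T', of c] \<open>cells lam = cells lam'\<close>
      by (cases "c \<in> cells lam") auto
  qed
qed

section \<open>Tableaux from words, and edges of the standard graph\<close>

lemma partition_add_cell:
  assumes lam: "partition_of m lam" and j: "1 \<le> j" "j = 1 \<or> row_len lam j < row_len lam (j - 1)"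
  shows "\<exists>lam'. partition_of (Suc m) lam' \<and> row_len lam' = (row_len lam)(j := Suc (row_len lam j))"
proof (cases "j \<le> length lam")
  case True
  let ?l = "lam[j - 1 := Suc (lam ! (j - 1))]"
  have sorted: "lam ! b \<le> lam ! a" if "a < b" "b < length lam" for a b
    using lam that unfolding partition_of_def sorted_wrt_iff_nth_less by simp
  have "?l ! b \<le> ?l ! a" if ab: "a < b" "b < length lam" for a b
  proof (cases "b = j - 1")
    case b: True
    have "lam ! b < lam ! (b - 1)" using j(2) b ab True unfolding row_len_def by (auto split: if_splits)
    moreover have "lam ! (b - 1) \<le> lam ! a" using sorted[of a "b - 1"] ab by (cases "a = b - 1") auto
    ultimately show ?thesis using ab b by (auto simp: nth_list_update)
  next
    case False
    have "j - 1 < length lam" using True j(1) by simp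
    then show ?thesis using False sorted[OF ab] by (auto simp: nth_list_update)
  qed
  then have "sorted_wrt (\<ge>) ?l" unfolding sorted_wrt_iff_nth_less by simp
  moreover have "\<forall>x\<in>set ?l. 0 < x"
    using lam set_update_subset_insert[of lam "j - 1" "Suc (lam ! (j - 1))"]
    unfolding partition_of_def by blast
  moreover have "sum_list ?l = Suc m"
  proof -
    have "j - 1 < length lam" using True j(1) by simp
    then have "sum_list ?l = sum_list lam + Suc (lam ! (j - 1)) - lam ! (j - 1)"
      by (rule sum_list_update)
    then show ?thesis using lam unfolding partition_of_def by simp
  qed
  moreover have "row_len ?l = (row_len lam)(j := Suc (row_len lam j))"
    using True j(1) unfolding row_len_def by (auto simp: fun_eq_iff nth_list_update)
  ultimately show ?thesis unfolding partition_of_def by blast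
next
  case False
  \<comment> \<open>Here row \<open>j\<close> is empty, so either \<open>j = 1\<close> and there are
    no rows at all, or row \<open>j - 1\<close> is nonempty and therefore the last one.\<close>
  then have jl: "j = Suc (length lam)" using j unfolding row_len_def by (cases "length lam = 0") (auto split: if_splits)
  have pos: "\<forall>x\<in>set lam. 1 \<le> x" using lam unfolding partition_of_def by auto
  have "partition_of (Suc m) (lam @ [1])"
    using lam pos unfolding partition_of_def by (auto simp: sorted_wrt_append)
  moreover have "row_len (lam @ [1]) = (row_len lam)(j := Suc (row_len lam j))"
    unfolding row_len_def jl by (auto simp: fun_eq_iff nth_append)
  ultimately show ?thesis by blast
qed

lemma SYT_add_cell:
  assumes lam: "partition_of m lam" and T: "T \<in> SYT lam"
    and lam': "partition_of (Suc m) lam'" and rl: "row_len lam' = (row_len lam)(j := Suc (row_len lam j))"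
    and j: "1 \<le> j"
  shows "\<exists>T'\<in>SYT lam'. tab_word lam' T' (Suc m) =
           (int (row_len lam j) + 1 - int j) # tab_word lam T m"
proof -
  let ?c = "(Suc (row_len lam j), j)"
  let ?T = "T(?c := Suc m)"
  have cells: "cells lam' = insert ?c (cells lam)"
    using j by (auto simp: cells_row_len rl split: if_splits)
  have new: "?c \<notin> cells lam" by (simp add: cells_row_len)
  have bound: "T c \<le> m" for c
    using SYT_range[OF lam T, of c] SYT_outside[OF T, of c] by (cases "c \<in> cells lam") auto
  have bijT: "bij_betw T (cells lam) {1..m}" by (rule SYT_bij[OF lam T])
  have "bij_betw ?T (cells lam) {1..m}"
    using bijT new by (subst bij_betw_cong[of _ _ T]) auto
  then have "bij_betw ?T (cells lam \<union> {?c}) ({1..m} \<union> {?T ?c})"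
    by (subst notIn_Un_bij_betw3[symmetric]) (use new in auto)
  moreover have "{1..m} \<union> {?T ?c} = {1..Suc m}" by auto
  ultimately have bij: "bij_betw ?T (cells lam') {1..sum_list lam'}"
    using lam' unfolding cells partition_of_def by simp
  have dec: "decreasing_rows (row_len lam)" by (rule decreasing_row_len[OF lam])
  \<comment> \<open>The new cell has no neighbour to the right or above, so it only has to exceed
    others, which \<open>Suc m\<close> does.\<close>
  have right: "(Suc (Suc (row_len lam j)), j) \<notin> cells lam'" by (simp add: cells_row_len rl)
  have up: "(Suc (row_len lam j), Suc j) \<notin> cells lam'"
    using decreasing_rowsD[OF dec j, of "Suc j"] by (simp add: cells_row_len rl)
  have "?T c = 0" if "c \<notin> cells lam'" for c
    using that SYT_outside[OF T, of c] unfolding cells by auto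
  moreover have "?T (i, k) < ?T (i + 1, k)" if c: "(i, k) \<in> cells lam'" "(i + 1, k) \<in> cells lam'" for i k
  proof -
    have ne: "(i, k) \<noteq> ?c" using c right by auto
    then have "(i, k) \<in> cells lam" using c cells by blast
    show ?thesis
    proof (cases "(i + 1, k) = ?c")
      case True then show ?thesis using ne bound[of "(i, k)"] by auto
    next
      case False
      then have "(i + 1, k) \<in> cells lam" using c cells by blast
      then have "T (i, k) < T (i + 1, k)" using T \<open>(i, k) \<in> cells lam\<close> unfolding SYT_def by blast
      then show ?thesis using ne False by auto
    qed
  qed
  moreover have "?T (i, k) < ?T (i, k + 1)" if c: "(i, k) \<in> cells lam'" "(i, k + 1) \<in> cells lam'" for i k
  proof -
    have ne: "(i, k) \<noteq> ?c" using c up by auto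
    then have "(i, k) \<in> cells lam" using c cells by blast
    show ?thesis
    proof (cases "(i, k + 1) = ?c")
      case True then show ?thesis using ne bound[of "(i, k)"] by auto
    next
      case False
      then have "(i, k + 1) \<in> cells lam" using c cells by blast
      then have "T (i, k) < T (i, k + 1)" using T \<open>(i, k) \<in> cells lam\<close> unfolding SYT_def by blast
      then show ?thesis using ne False by auto
    qed
  qed
  ultimately have T': "?T \<in> SYT lam'" using bij unfolding SYT_def mem_Collect_eq by blast
  have "cell_of lam' ?T k = cell_of lam T k" if k: "1 \<le> k" "k \<le> m" for k
  proof -
    have c: "cell_of lam T k \<in> cells lam" "T (cell_of lam T k) = k"
      using cell_of_props[OF lam T k] by auto
    then have "?T (cell_of lam T k) = k" "cell_of lam T k \<in> cells lam'" using new cells by auto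
    then show ?thesis using cell_of_eq[OF lam' T', of "cell_of lam T k"] by simp
  qed
  then have "tab_word lam' ?T m = tab_word lam T m"
    unfolding tab_word_def by (intro rev_word_cong) simp
  moreover have "cell_of lam' ?T (Suc m) = ?c"
    using cell_of_eq[OF lam' T', of ?c] cells by simp
  ultimately have "tab_word lam' ?T (Suc m) = (int (row_len lam j) + 1 - int j) # tab_word lam T m"
    unfolding tab_word_def by (simp add: content_def)
  with T' show ?thesis by blast
qed

lemma tab_word_exists:
  "cword w \<Longrightarrow> \<exists>lam T. partition_of (length w) lam \<and> T \<in> SYT lam \<and> tab_word lam T (length w) = w"
proof (induction w)
  case Nil
  have "cells [] = {}" by (auto simp: cells_def)
  then have "partition_of 0 []" "(\<lambda>_. 0) \<in> SYT []"
    unfolding partition_of_def SYT_def by (auto simp: bij_betw_def)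
  then show ?case by (auto simp: tab_word_def)
next
  case (Cons c w)
  let ?m = "length w"
  obtain lam T where lam: "partition_of ?m lam" and T: "T \<in> SYT lam" and w: "tab_word lam T ?m = w"
    using Cons by auto
  have "addable (maya (row_len lam)) c"
    using Cons.prems shape_tab_word[OF lam T] w by simp
  then obtain j where j: "1 \<le> j" "c = int (row_len lam j) + 1 - int j"
      "j = 1 \<or> row_len lam j < row_len lam (j - 1)"
    using maya_addableD[OF decreasing_row_len[OF lam]] by blast
  obtain lam' where lam': "partition_of (Suc ?m) lam'" "row_len lam' = (row_len lam)(j := Suc (row_len lam j))"
    using partition_add_cell[OF lam j(1,3)] by blast
  from SYT_add_cell[OF lam T lam' j(1)] lam'(1) show ?case
    unfolding w j(2)[symmetric] by auto
qed

text \<open>The path of dual moves from the word of \<open>T\<close> is followed by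
  \<open>dop\<close> inside \<open>SYT lam\<close>, which keeps the given partition.\<close>

lemma tab_word_same_shape:
  assumes lam: "partition_of m lam" and T: "T \<in> SYT lam"
    and w: "cword w" "length w = m" "shape w = shape (tab_word lam T m)"
  shows "\<exists>S\<in>SYT lam. tab_word lam S m = w"
proof -
  have "cword (tab_word lam T m)" "length (tab_word lam T m) = length w"
    using tab_word_cword[OF lam T, of m] w(2) by (auto simp: tab_word_def)
  from this(1) w(1) this(2) w(3)[symmetric] show ?thesis
  proof (induction rule: word_dual_connected)
    case start then show ?case using T by blast
  next
    case (step v i)
    then obtain S where "S \<in> SYT lam" "tab_word lam S m = v" by blast
    then show ?case using dop_tab_word[OF lam, of S i] step w(2) by metis
  qed
qed

text \<open>An edge is an unordered pair, so \<open>dop\<close> may have been applied at either end;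
  the involution property covers the second reading.\<close>

lemma Gstd_edge_tab_word:
  assumes lam: "partition_of m lam" and i: "1 < i" "i < m" and e: "{T, S} \<in> edges (Gstd lam) i"
  shows "tab_word lam S m = word_dual i (tab_word lam T m)"
proof -
  have sum: "sum_list lam = m" using lam unfolding partition_of_def by simp
  obtain U where U: "{T, S} = {U, dop lam i U}" "U \<in> SYT lam"
    using e i unfolding Gstd_def sum by auto
  have *: "tab_word lam (dop lam i U) m = word_dual i (tab_word lam U m)"
    by (rule dop_tab_word[OF lam U(2) i])
  have "word_dual i (word_dual i (tab_word lam U m)) = tab_word lam U m"
    using tab_word_cword[OF lam U(2), of m] by (intro word_dual_involution) simp
  then show ?thesis using U(1) * by (auto simp: doubleton_eq_iff)
qed

lemma Gstd_edgeI:
  assumes lam: "partition_of m lam" and i: "1 < i" "i < m" and TS: "T \<in> SYT lam" "S \<in> SYT lam"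
    and w: "tab_word lam S m = word_dual i (tab_word lam T m)" "tab_word lam S m \<noteq> tab_word lam T m"
  shows "{T, S} \<in> edges (Gstd lam) i"
proof -
  have sum: "sum_list lam = m" using lam unfolding partition_of_def by simp
  have "S = dop lam i T"
    using tab_word_inj(2)[OF lam TS(2) lam] dop_tab_word[OF lam TS(1) i] w(1) by metis
  moreover have "S \<noteq> T" using w(2) by auto
  ultimately show ?thesis unfolding Gstd_def sum using i TS by auto
qed

section \<open>Edges of the top color\<close>

lemma scg_edge_verts:
  assumes "is_scg n N G" "1 < i" "i < n" "{u, v} \<in> edges G i"
  shows "u \<in> verts G" "v \<in> verts G" "u \<noteq> v"
proof -
  have "\<exists>a b. a \<in> verts G \<and> b \<in> verts G \<and> a \<noteq> b \<and> {u, v} = {a, b}"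
    using assms unfolding is_scg_def by blast
  then show "u \<in> verts G" "v \<in> verts G" "u \<noteq> v" by (auto simp: doubleton_eq_iff)
qed

lemma scg_sig_range:
  "is_scg n N G \<Longrightarrow> v \<in> verts G \<Longrightarrow> 1 \<le> j \<Longrightarrow> j < N \<Longrightarrow> sig G v j \<in> {1, -1}"
  unfolding is_scg_def by blast

lemma col_rel_sym: "sym ((col_rel G I)\<^sup>*)"
proof (rule sym_rtrancl)
  show "sym (col_rel G I)"
    unfolding sym_def col_rel_def by (simp add: insert_commute)
qed

lemma col_comp_eq: "v \<in> col_comp G I u \<Longrightarrow> col_comp G I v = col_comp G I u"
  unfolding col_comp_def using symD[OF col_rel_sym, of u v G I] by (auto intro: rtrancl_trans)

lemma component_edge: "{u, v} \<in> edges G i \<Longrightarrow> i \<in> I \<Longrightarrow> u \<in> col_comp G I w \<Longrightarrow> v \<in> col_comp G I w"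
  unfolding col_comp_def col_rel_def by (auto intro: rtrancl.rtrancl_into_rtrancl)

lemma component_self: "u \<in> col_comp G I u"
  unfolding col_comp_def by simp

text \<open>The state of knowledge before color \<open>n\<close> is treated: labels reproduce all
  \<open>n\<close> coordinates, but obey the dual moves only for smaller colors, and their shapes
  may vary from component to component.\<close>

locale word_labelled_graph =
  fixes G :: "'v scg" and n :: nat and \<Phi> :: "'v \<Rightarrow> int list"
  assumes scg: "is_scg (n + 1) (n + 1) G"
    and axs: "scg_axioms (n + 1) (n + 1) G"
    and cword_label: "v \<in> verts G \<Longrightarrow> cword (\<Phi> v)"
    and length_label: "v \<in> verts G \<Longrightarrow> length (\<Phi> v) = n + 1"
    and sig_label: "v \<in> verts G \<Longrightarrow> 1 \<le> i \<Longrightarrow> i \<le> n \<Longrightarrow> word_sig (\<Phi> v) i = sig G v i"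
    and low_edge: "1 < i \<Longrightarrow> i < n \<Longrightarrow> {u, v} \<in> edges G i \<Longrightarrow> \<Phi> v = word_dual i (\<Phi> u)"
begin

lemma edge_verts:
  assumes "{u, v} \<in> edges G i" "1 < i" "i \<le> n"
  shows "u \<in> verts G" "v \<in> verts G" "u \<noteq> v"
  using scg_edge_verts[OF scg assms(2) _ assms(1)] assms(3) by auto

lemma edge_iff:
  assumes "u \<in> verts G" "1 < i" "i \<le> n"
  shows "(\<exists>v. {u, v} \<in> edges G i) \<longleftrightarrow> word_sig (\<Phi> u) (i - 1) \<noteq> word_sig (\<Phi> u) i"
proof -
  have "ax1 (n + 1) (n + 1) G" using axs unfolding scg_axioms_def by blast
  moreover have "1 < i \<and> i < n + 1" "sc (n + 1) (i - 1) \<and> sc (n + 1) i"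
    using assms by (auto simp: sc_def)
  ultimately have "sig G u (i - 1) = - sig G u i \<longleftrightarrow> (\<exists>v. {u, v} \<in> edges G i)"
    using assms(1) unfolding ax1_def by blast
  moreover have "word_sig (\<Phi> u) (i - 1) = sig G u (i - 1)" "word_sig (\<Phi> u) i = sig G u i"
    using assms sig_label by auto
  moreover have "word_sig (\<Phi> u) (i - 1) \<in> {1, -1}" "word_sig (\<Phi> u) i \<in> {1, -1}"
    using assms length_label word_sig_range[of "i - 1" "\<Phi> u"] word_sig_range[of i "\<Phi> u"] by auto
  ultimately show ?thesis by auto
qed

lemma edge_dual:
  assumes "u \<in> verts G" "1 < i" "i < n" "word_dual i (\<Phi> u) \<noteq> \<Phi> u"
  shows "\<exists>v. {u, v} \<in> edges G i \<and> \<Phi> v = word_dual i (\<Phi> u)"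
  using edge_iff[of u i] word_dual_fixed_iff[of "\<Phi> u" i] assms cword_label length_label low_edge
  by fastforce

lemma top_edge_sig:
  assumes "{u, v} \<in> edges G n" "1 < n"
  shows "j = n - 1 \<or> j = n \<Longrightarrow> word_sig (\<Phi> u) j = - word_sig (\<Phi> v) j"
    and "1 \<le> j \<Longrightarrow> j + 2 < n \<Longrightarrow> word_sig (\<Phi> u) j = word_sig (\<Phi> v) j"
    and "2 < n \<Longrightarrow> word_sig (\<Phi> u) (n - 2) \<noteq> word_sig (\<Phi> v) (n - 2) \<Longrightarrow>
         word_sig (\<Phi> u) (n - 2) = - word_sig (\<Phi> u) (n - 1)"
proof -
  have V: "u \<in> verts G" "v \<in> verts G" using edge_verts[OF assms(1)] assms by auto
  have L: "word_sig (\<Phi> u) j = sig G u j \<and> word_sig (\<Phi> v) j = sig G v j" if "1 \<le> j" "j \<le> n" for j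
    using sig_label V that by simp
  have "ax2 (n + 1) (n + 1) G" "ax3 (n + 1) (n + 1) G"
    using axs unfolding scg_axioms_def by auto
  moreover have "1 < n \<and> n < n + 1" using assms(2) by simp
  ultimately have ax2: "\<forall>j\<in>{n - 1, n}. sc (n + 1) j \<longrightarrow> sig G u j = - sig G v j"
      "\<forall>j. sc (n + 1) j \<and> (j + 2 < n \<or> j > n + 1) \<longrightarrow> sig G u j = sig G v j"
    and ax3: "n \<ge> 3 \<and> sc (n + 1) (n - 2) \<and> sc (n + 1) (n - 1) \<and> sig G u (n - 2) = - sig G v (n - 2)
        \<longrightarrow> sig G u (n - 2) = - sig G u (n - 1)"
    using assms(1) unfolding ax2_def ax3_def by blast+
  show "word_sig (\<Phi> u) j = - word_sig (\<Phi> v) j" if "j = n - 1 \<or> j = n"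
  proof -
    have "1 \<le> j" "j \<le> n" using that assms(2) by auto
    moreover from this have "sig G u j = - sig G v j" using ax2(1) that by (auto simp: sc_def)
    ultimately show ?thesis using L by metis
  qed
  show "word_sig (\<Phi> u) j = word_sig (\<Phi> v) j" if "1 \<le> j" "j + 2 < n"
    using ax2(2) L[of j] that by (auto simp: sc_def)
  show "word_sig (\<Phi> u) (n - 2) = - word_sig (\<Phi> u) (n - 1)"
    if "2 < n" "word_sig (\<Phi> u) (n - 2) \<noteq> word_sig (\<Phi> v) (n - 2)"
  proof -
    have "word_sig (\<Phi> u) (n - 2) \<in> {1, -1}" "word_sig (\<Phi> v) (n - 2) \<in> {1, -1}"
      using V length_label that(1) word_sig_range[of "n - 2" "\<Phi> u"] word_sig_range[of "n - 2" "\<Phi> v"]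
      by auto
    then have "word_sig (\<Phi> u) (n - 2) = - word_sig (\<Phi> v) (n - 2)" using that(2) by auto
    then have "sig G u (n - 2) = - sig G v (n - 2)"
      using L[of "n - 2"] that(1) by simp
    then have "sig G u (n - 2) = - sig G u (n - 1)"
      using ax3 that(1) by (auto simp: sc_def)
    then show ?thesis using L[of "n - 2"] L[of "n - 1"] that(1) by simp
  qed
qed

section \<open>Moving a top edge by moves of distant colors\<close>

text \<open>Colors below \<open>n - 2\<close> differ from \<open>n\<close> by at least three, so the
  fifth axiom completes the square. If the move fixes one end, it fixes the other, because
  coordinates \<open>i - 1\<close> and \<open>i\<close> agree along the edge.\<close>

lemma commuting_step:
  assumes e: "{u, v} \<in> edges G n" and i2: "1 < i" "i < n - 2"
  shows "\<exists>u' v'. {u', v'} \<in> edges G n \<and> \<Phi> u' = word_dual i (\<Phi> u) \<and> \<Phi> v' = word_dual i (\<Phi> v)"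
proof (cases "word_dual i (\<Phi> u) = \<Phi> u")
  case True
  have i: "1 < i" "i + 3 \<le> n" using i2 by arith+
  have V: "u \<in> verts G" "v \<in> verts G" using edge_verts[OF e] i by auto
  have "word_sig (\<Phi> u) (i - 1) = word_sig (\<Phi> v) (i - 1)" "word_sig (\<Phi> u) i = word_sig (\<Phi> v) i"
    using top_edge_sig(2)[OF e] i by auto
  then have "word_dual i (\<Phi> v) = \<Phi> v"
    using True word_dual_fixed_iff[of _ i] V cword_label length_label i by simp
  then show ?thesis using True e by metis
next
  case False
  have i: "1 < i" "i + 3 \<le> n" using i2 by arith+
  have "u \<in> verts G" using edge_verts[OF e] i by auto
  then obtain u' where u': "{u, u'} \<in> edges G i" "\<Phi> u' = word_dual i (\<Phi> u)"
    using edge_dual[OF _ _ _ False] i by auto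
  have "{u', u} \<in> edges G i" using u' by (simp add: insert_commute)
  then obtain v' where v': "{u', v'} \<in> edges G n" "{v', v} \<in> edges G i"
  proof -
    have "ax5 (n + 1) (n + 1) G" using axs unfolding scg_axioms_def by blast
    moreover have "1 < i \<and> i < n + 1 \<and> 1 < n \<and> n < n + 1" "i + 3 \<le> n \<or> n + 3 \<le> i"
      using i by auto
    ultimately show ?thesis using \<open>{u', u} \<in> edges G i\<close> e that unfolding ax5_def by blast
  qed
  then have "\<Phi> v' = word_dual i (\<Phi> v)"
    using low_edge[of i v v'] i by (simp add: insert_commute)
  then show ?thesis using u' v' by blast
qed

lemma top_edge_tail:
  assumes e: "{u, v} \<in> edges G n" and n: "1 < n"
    and uv: "\<Phi> u = d # b # a # p" "\<Phi> v = d' # b' # a' # p'"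
  shows "p = p'"
proof -
  \<comment> \<open>The edge and the three top letters at either end are quantified away, so that
    \<open>R\<close> is closed under the moves of color below \<open>n - 2\<close>.\<close>
  define R where "R = (\<lambda>p q. \<exists>u v d b a d' b' a'. {u, v} \<in> edges G n \<and>
    \<Phi> u = d # b # a # p \<and> \<Phi> v = d' # b' # a' # q)"
  have len: "cword p \<and> cword q \<and> length p = n - 2 \<and> length q = n - 2" if R: "R p q" for p q
  proof -
    obtain u v d b a d' b' a' where r: "{u, v} \<in> edges G n"
      "\<Phi> u = d # b # a # p" "\<Phi> v = d' # b' # a' # q" using R R_def by blast
    have "u \<in> verts G" "v \<in> verts G" using edge_verts[OF r(1)] n by auto
    then show ?thesis
      using cword_label[of u] cword_label[of v] length_label[of u] length_label[of v] r by auto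
  qed
  show ?thesis
  proof (rule bisimilar_words_equal[of R "n - 2"])
    fix p q assume R: "R p q"
    then obtain u v d b a d' b' a' where r: "{u, v} \<in> edges G n"
      "\<Phi> u = d # b # a # p" "\<Phi> v = d' # b' # a' # q" using R_def by blast
    show "cword p \<and> cword q \<and> length p = n - 2 \<and> length q = n - 2" by (rule len[OF R])
    show "word_sig p i = word_sig q i" if "1 \<le> i" "i < n - 2" for i
      using top_edge_sig(2)[OF r(1), of i] that len[OF R] r(2,3) by (simp add: word_sig_Cons)
    show "R (word_dual i p) (word_dual i q)" if i: "1 < i" "i < n - 2" for i
    proof -
      obtain u' v' where e: "{u', v'} \<in> edges G n" "\<Phi> u' = word_dual i (\<Phi> u)"
         "\<Phi> v' = word_dual i (\<Phi> v)"
        using commuting_step[OF r(1), of i] i by auto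
      have "\<Phi> u' = d # b # a # word_dual i p" "\<Phi> v' = d' # b' # a' # word_dual i q"
        using e r i len[OF R] by (auto simp: word_dual_Cons)
      with e show ?thesis unfolding R_def by blast
    qed
  next
    show "R p p'" using e uv R_def by blast
  qed
qed

text \<open>Moves of color below \<open>n - 2\<close> act on the tail only and keep the three top
  letters at both ends. Contradictions can therefore be sought after a convenient rearrangement of
  the tail.\<close>

lemma top_edge_transport:
  assumes e: "{u, v} \<in> edges G n" and n: "1 < n"
    and uv: "\<Phi> u = d # b # a # p" "\<Phi> v = d' # b' # a' # p"
    and q: "cword q" "length p = length q" "shape p = shape q"
  shows "\<exists>u v. {u, v} \<in> edges G n \<and> \<Phi> u = d # b # a # q \<and> \<Phi> v = d' # b' # a' # q"
proof -
  have "u \<in> verts G" using edge_verts[OF e] n by auto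
  then have p: "cword p" "length p = n - 2"
    using cword_label[of u] length_label[of u] uv by auto
  from p(1) q show ?thesis
  proof (induction rule: word_dual_connected)
    case start
    then show ?case using e uv by blast
  next
    case (step w i)
    then obtain u v where r: "{u, v} \<in> edges G n"
      "\<Phi> u = d # b # a # w" "\<Phi> v = d' # b' # a' # w" by blast
    obtain u' v' where e: "{u', v'} \<in> edges G n" "\<Phi> u' = word_dual i (\<Phi> u)"
         "\<Phi> v' = word_dual i (\<Phi> v)"
      using commuting_step[OF r(1), of i] step p q by auto
    have "\<Phi> u' = d # b # a # word_dual i w" "\<Phi> v' = d' # b' # a' # word_dual i w"
      using e r step by (auto simp: word_dual_Cons)
    with e show ?case by blast
  qed
qed

section \<open>Small components under the fourth axiom\<close>

text \<open>In a three-vertex path \<open>u\<close> would be the middle and \<open>w\<close>,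
  \<open>v\<close> ends with no further edge. One more edge at an end leaves only the double
  edge.\<close>

lemma two_color_double_edge:
  assumes i: "2 < i" "i \<le> n"
    and e: "{u, v} \<in> edges G i" "{u, w} \<in> edges G (i - 1)"
    and "(\<exists>z. {w, z} \<in> edges G i) \<or> (\<exists>z. {v, z} \<in> edges G (i - 1))"
  shows "v = w"
proof -
  define C where "C = col_comp G {i - 1, i} u"
  have V: "u \<in> verts G" using edge_verts[OF e(1)] i by auto
  have ne: "u \<noteq> v" "u \<noteq> w" using edge_verts(3)[OF e(1)] edge_verts(3)[OF e(2)] i by auto
  have uC: "u \<in> C" unfolding C_def by (rule component_self)
  have vC: "v \<in> C" using component_edge[OF e(1)] uC unfolding C_def by blast
  have wC: "w \<in> C" using component_edge[OF e(2)] uC unfolding C_def by blast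
  have E: "{u, v} \<in> ecol G C i" "{u, w} \<in> ecol G C (i - 1)"
    using e uC vC wC unfolding ecol_def by auto
  have E': "(\<exists>z. {w, z} \<in> ecol G C i) \<or> (\<exists>z. {v, z} \<in> ecol G C (i - 1))"
  proof -
    have "z \<in> C" if "{w, z} \<in> edges G i" for z using component_edge[OF that] wC unfolding C_def by blast
    moreover have "z \<in> C" if "{v, z} \<in> edges G (i - 1)" for z
      using component_edge[OF that] vC unfolding C_def by blast
    ultimately show ?thesis using assms(5) wC vC unfolding ecol_def by auto
  qed
  have "C = {u} \<or>
      (\<exists>x y z. distinct [x, y, z] \<and> C = {x, y, z} \<and>
         ecol G C (i - 1) = {{x, y}} \<and> ecol G C i = {{y, z}}) \<or>
      (\<exists>x y. x \<noteq> y \<and> C = {x, y} \<and>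
         ecol G C (i - 1) = {{x, y}} \<and> ecol G C i = {{x, y}})"
    using axs V i unfolding scg_axioms_def ax4_def C_def Let_def by simp
  then show ?thesis
  proof (elim disjE exE conjE)
    assume "C = {u}" then show ?thesis using vC wC by simp
  next
    fix x y z assume "distinct [x, y, z]" "ecol G C (i - 1) = {{x, y}}" "ecol G C i = {{y, z}}"
    then show ?thesis using E E' ne by (auto simp: doubleton_eq_iff)
  next
    fix x y assume "x \<noteq> y" "ecol G C (i - 1) = {{x, y}}" "ecol G C i = {{x, y}}"
    then show ?thesis using E E' ne by (auto simp: doubleton_eq_iff)
  qed
qed

text \<open>The vertex \<open>x\<close> meets all three colors, which happens only in the components
  of five and six vertices. These give the two alternatives: a double edge at \<open>w1\<close>, or
  the closing side of the square.\<close>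

lemma three_color_square:
  assumes i: "3 < i" "i \<le> n"
    and e: "{x, w} \<in> edges G i" "{x, x1} \<in> edges G (i - 2)" "{x, x2} \<in> edges G (i - 1)"
      "{w, w1} \<in> edges G (i - 2)"
    and no: "\<nexists>z. {w, z} \<in> edges G (i - 1)"
  shows "(x1 = x2 \<and> (\<exists>z. {w1, z} \<in> edges G (i - 1) \<and> {w1, z} \<in> edges G i)) \<or> {w1, x1} \<in> edges G i"
proof -
  define C where "C = col_comp G {i - 2, i - 1, i} x"
  have V: "x \<in> verts G" using edge_verts[OF e(1)] i by auto
  have xC: "x \<in> C" unfolding C_def by (rule component_self)
  have step: "b \<in> C" if "{a, b} \<in> edges G j" "j \<in> {i - 2, i - 1, i}" "a \<in> C" for a b j
    using component_edge[OF that(1,2), of x] that(3) unfolding C_def by simp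
  have wC: "w \<in> C" by (rule step[OF e(1) _ xC]) simp
  have x1C: "x1 \<in> C" by (rule step[OF e(2) _ xC]) simp
  have x2C: "x2 \<in> C" by (rule step[OF e(3) _ xC]) simp
  have w1C: "w1 \<in> C" by (rule step[OF e(4) _ wC]) simp
  have E: "{x, w} \<in> ecol G C i" "{x, x1} \<in> ecol G C (i - 2)" "{x, x2} \<in> ecol G C (i - 1)"
      "{w, w1} \<in> ecol G C (i - 2)"
    using e xC wC x1C x2C w1C unfolding ecol_def by auto
  have no': "{w, z} \<notin> ecol G C (i - 1)" "{z, w} \<notin> ecol G C (i - 1)" for z
    using no unfolding ecol_def by (auto simp: insert_commute)
  have goal: ?thesis if "(x1 = x2 \<and> (\<exists>z. {w1, z} \<in> ecol G C (i - 1) \<and> {w1, z} \<in> ecol G C i)) 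
      \<or> {w1, x1} \<in> ecol G C i"
    using that unfolding ecol_def by auto
  have "C = {x} \<or>
      (\<exists>p q r s. distinct [p, q, r, s] \<and> C = {p, q, r, s} \<and>
         ecol G C (i - 2) = {{p, q}} \<and> ecol G C (i - 1) = {{q, r}} \<and>
         ecol G C i = {{r, s}}) \<or>
      (\<exists>a b c d e. distinct [a, b, c, d, e] \<and> C = {a, b, c, d, e} \<and>
         ecol G C (i - 2) = {{a, b}, {c, d}} \<and> ecol G C (i - 1) = {{a, b}, {d, e}} \<and>
         ecol G C i = {{b, c}, {d, e}}) \<or>
      (\<exists>u v' w x y z. distinct [u, v', w, x, y, z] \<and> C = {u, v', w, x, y, z} \<and>
         ecol G C (i - 1) = {{u, v'}, {y, z}} \<and> ecol G C (i - 2) = {{v', w}, {x, y}} \<and>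
         ecol G C i = {{v', x}, {w, y}})"
    using axs V i unfolding scg_axioms_def ax4_def C_def Let_def by simp
  then show ?thesis
  proof (elim disjE exE conjE)
    assume "C = {x}" 
    then show ?thesis using wC edge_verts(3)[OF e(1)] i by simp
  next
    fix p q r s assume dist: "distinct [p, q, r, s]" and
      ec: "ecol G C (i - 2) = {{p, q}}" "ecol G C (i - 1) = {{q, r}}" "ecol G C i = {{r, s}}"
    have "x \<in> {p, q}" "x \<in> {r, s}" using E(1,2)[unfolded ec] by (metis insertCI singletonD)+
    then show ?thesis using dist by auto
  next
    fix a b c d f assume dist: "distinct [a, b, c, d, f]" and
      ec: "ecol G C (i - 2) = {{a, b}, {c, d}}" "ecol G C (i - 1) = {{a, b}, {d, f}}"
         "ecol G C i = {{b, c}, {d, f}}"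
    have F1: "(x = b \<and> w = c) \<or> (x = c \<and> w = b) \<or> (x = d \<and> w = f) \<or> (x = f \<and> w = d)"
      using E(1) unfolding ec by (simp add: doubleton_eq_iff)
    have F2: "(x = a \<and> x1 = b) \<or> (x = b \<and> x1 = a) \<or> (x = c \<and> x1 = d) \<or> (x = d \<and> x1 = c)"
      using E(2) unfolding ec by (simp add: doubleton_eq_iff)
    have F3: "(x = a \<and> x2 = b) \<or> (x = b \<and> x2 = a) \<or> (x = d \<and> x2 = f) \<or> (x = f \<and> x2 = d)"
      using E(3) unfolding ec by (simp add: doubleton_eq_iff)
    have F4: "(w = a \<and> w1 = b) \<or> (w = b \<and> w1 = a) \<or> (w = c \<and> w1 = d) \<or> (w = d \<and> w1 = c)"
      using E(4) unfolding ec by (simp add: doubleton_eq_iff)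
    \<comment> \<open>Of \<open>b\<close> and \<open>d\<close>, the vertices meeting all three
      colors, \<open>d\<close> has its edge of color \<open>i\<close> to \<open>f\<close>, which
      meets color \<open>i - 1\<close> against \<open>no\<close>. So \<open>x\<close> is
      \<open>b\<close>.\<close>
    have "w \<noteq> f" using no'(2)[of d] unfolding ec by auto
    with F1 F2 F3 F4 dist have "x = b" "w = c" "x1 = a" "x2 = a" "w1 = d" by auto
    then show ?thesis by (intro goal[unfolded ec]) auto
  next
    fix u v' w' x' y z assume dist: "distinct [u, v', w', x', y, z]" and
      ec: "ecol G C (i - 1) = {{u, v'}, {y, z}}" "ecol G C (i - 2) = {{v', w'}, {x', y}}"
         "ecol G C i = {{v', x'}, {w', y}}"
    have F1: "(x = v' \<and> w = x') \<or> (x = x' \<and> w = v') \<or> (x = w' \<and> w = y) \<or> (x = y \<and> w = w')"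
      using E(1) unfolding ec by (simp add: doubleton_eq_iff)
    have F2: "(x = v' \<and> x1 = w') \<or> (x = w' \<and> x1 = v') \<or> (x = x' \<and> x1 = y) \<or> (x = y \<and> x1 = x')"
      using E(2) unfolding ec by (simp add: doubleton_eq_iff)
    have F3: "(x = u \<and> x2 = v') \<or> (x = v' \<and> x2 = u) \<or> (x = y \<and> x2 = z) \<or> (x = z \<and> x2 = y)"
      using E(3) unfolding ec by (simp add: doubleton_eq_iff)
    have F4: "(w = v' \<and> w1 = w') \<or> (w = w' \<and> w1 = v') \<or> (w = x' \<and> w1 = y) \<or> (w = y \<and> w1 = x')"
      using E(4) unfolding ec by (simp add: doubleton_eq_iff)
    have "(x1 = w' \<and> w1 = y) \<or> (x1 = x' \<and> w1 = v')"
      using F1 F2 F3 F4 dist by auto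
    then show ?thesis by (intro goal[unfolded ec]) auto
  qed
qed

section \<open>Determining the far end of a top edge\<close>

text \<open>From here on \<open>d\<close>, \<open>b\<close>, \<open>a\<close> are the contents of
  the entries \<open>n + 1\<close>, \<open>n\<close>, \<open>n - 1\<close>, and \<open>p\<close>
  holds the contents of the entries up to \<open>n - 2\<close>.\<close>

lemma top_edge_labels:
  assumes e: "{u, v} \<in> edges G n" and n: "1 < n"
  obtains d b a d' b' a' p where "\<Phi> u = d # b # a # p" "\<Phi> v = d' # b' # a' # p" "length p + 2 = n"
    "cword (d # b # a # p)" "cword (d' # b' # a' # p)"
proof -
  have V: "u \<in> verts G" "v \<in> verts G" using edge_verts[OF e] n by auto
  have long: "\<exists>d b a p. \<Phi> u = d # b # a # p" if "u \<in> verts G" for u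
  proof -
    have "length (\<Phi> u) = Suc (Suc (Suc (n - 2)))" using length_label[OF that] n by simp
    then show ?thesis by (auto simp: length_Suc_conv)
  qed
  obtain d b a p d' b' a' p' where uv: "\<Phi> u = d # b # a # p" "\<Phi> v = d' # b' # a' # p'"
    using long V by metis
  have "p' = p" using top_edge_tail[OF e n uv] by simp
  moreover have "length p + 2 = n" using length_label[OF V(1)] uv by simp
  moreover have "cword (d # b # a # p)" "cword (d' # b' # a' # p')"
    using cword_label V uv by metis+
  ultimately show ?thesis using that uv by blast
qed

lemma top_sig:
  assumes "length p + 2 = n"
  shows "word_sig (d # b # a # p) n = (if b < d then 1 else -1)"
    "word_sig (d # b # a # p) (n - 1) = (if a < b then 1 else -1)"
  using assms by auto

text \<open>By the first axiom coordinates \<open>n - 1\<close> and \<open>n\<close> differ, so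
  \<open>b\<close> is extreme. Two cases remain: inner, with \<open>d\<close> between
  \<open>a\<close> and \<open>b\<close>, where the dual move exchanges \<open>b\<close> and
  \<open>a\<close>; outer, with \<open>a\<close> between \<open>b\<close> and \<open>d\<close>,
  where it exchanges \<open>d\<close> and \<open>b\<close>.\<close>

lemma top_edge_not_between:
  assumes e: "{u, v} \<in> edges G n" and n: "1 < n"
    and u: "\<Phi> u = d # b # a # p"
  shows "(b < a \<and> b < d) \<or> (a < b \<and> d < b)"
proof -
  have V: "u \<in> verts G" using edge_verts[OF e] n by auto
  have len: "length p + 2 = n" using length_label[OF V] u by simp
  have "b \<noteq> a" "d \<noteq> b"
    using cword_label[OF V] u cword_distinct2[of d b "a # p"] cword_distinct2[of b a p] by auto
  moreover have "word_sig (\<Phi> u) (n - 1) \<noteq> word_sig (\<Phi> u) n"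
    using edge_iff[OF V n] e by blast
  ultimately show ?thesis
    unfolding u top_sig[OF len] by (auto split: if_splits)
qed

text \<open>The edge stays inside its component of lower color when the largest entry separates the next
  two: a suitable position of the third one turns the edge into one half of a double edge.\<close>

lemma top_edge_inner:
  assumes e: "{u, v} \<in> edges G n" and n: "1 < n"
    and u: "\<Phi> u = d # b # a # p" and btw: "strictly_between a d b"
  shows "\<Phi> v = d # a # b # p"
proof -
  obtain d' b' a' where v: "\<Phi> v = d' # b' # a' # p" and len: "length p + 2 = n"
      and cw: "cword (d # b # a # p)"
    using top_edge_labels[OF e n] u by (metis list.inject)
  have gap: "\<bar>b - a\<bar> \<ge> 2" using strictly_between_gap[OF btw] by simp
  have cw3: "cword (b # a # p)" using cw by simp
  have rem: "removable (shape (b # a # p)) b" "removable (shape (b # a # p)) a"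
    using cword_hd_removable[OF cw3] cword_hd_removable[of a "b # p"] cword_swap[OF cw3 gap] by auto
  have sp: "remove_cell (remove_cell (shape (b # a # p)) b) a = shape p"
    using cw3 by (simp add: remove_add_cell)
  have "b \<noteq> a" using gap by auto
  then obtain f where f: "removable (shape p) f" "strictly_between b f a"
    using removable_between_removable[OF rem] unfolding sp by blast
  obtain r where r: "cword (f # r)" "length (f # r) = length p" "shape (f # r) = shape p"
    using cword_removable[OF _ f(1)] cw by auto
  obtain u1 v1 where e1: "{u1, v1} \<in> edges G n" 
    and u1: "\<Phi> u1 = d # b # a # f # r" and v1: "\<Phi> v1 = d' # b' # a' # f # r"
    using top_edge_transport[OF e n u v r(1)] r by metis
  have V1: "u1 \<in> verts G" "v1 \<in> verts G" using edge_verts[OF e1] n by auto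
  have n2: "2 < n" and n1: "n - 1 = length r + 2" and n3: "n = length r + 3" using len r(2) by auto
  \<comment> \<open>With \<open>f\<close> between \<open>b\<close> and \<open>a\<close>, the move of
    color \<open>n - 1\<close> makes the very exchange expected from color \<open>n\<close>.\<close>
  have dual: "word_dual (n - 1) (\<Phi> u1) = d # a # b # f # r"
    using u1 n1 word_dual_top_between[OF f(2), of r] by (simp add: word_dual_Cons)
  have low: "1 < n - 1" "n - 1 < n" using n2 by arith+
  have "word_dual (n - 1) (\<Phi> u1) \<noteq> \<Phi> u1" unfolding dual unfolding u1 using \<open>b \<noteq> a\<close> by simp
  then obtain w where w: "{u1, w} \<in> edges G (n - 1)" "\<Phi> w = d # a # b # f # r"
    using edge_dual[OF V1(1) low] unfolding dual by blast
  have "w \<in> verts G" using edge_verts(2)[OF w(1)] n2 by simp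
  \<comment> \<open>In the label of \<open>w\<close> the second letter \<open>a\<close> is again
    extreme among the top three, so \<open>w\<close> also has an edge of color
    \<open>n\<close>.\<close>
  moreover have "word_sig (\<Phi> w) (n - 1) \<noteq> word_sig (\<Phi> w) n"
    using w(2) n3 btw by (auto simp: strictly_between_def)
  ultimately have "\<exists>z. {w, z} \<in> edges G n" using edge_iff[of w n] n by simp
  then have "v1 = w" using two_color_double_edge[OF n2 _ e1 w(1)] by blast
  then show ?thesis using w(2) v1 v by simp
qed

text \<open>If the far end were inner, reading the edge backwards through
  \<open>top_edge_inner\<close> would make the near end inner too.\<close>

lemma top_edge_outer_between:
  assumes e: "{u, v} \<in> edges G n" and n: "1 < n"
    and u: "\<Phi> u = d # b # a # p" and v: "\<Phi> v = d' # b' # a' # p"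
    and btw: "strictly_between b a d"
  shows "strictly_between b' a' d'"
proof -
  have V: "v \<in> verts G" using edge_verts[OF e] n by auto
  have e': "{v, u} \<in> edges G n" using e by (simp add: insert_commute)
  have "a' \<noteq> d'"
    using cword_label[OF V] v cword_distinct3[of d' b' a' p] by auto
  moreover have "\<not> strictly_between a' d' b'"
  proof
    assume "strictly_between a' d' b'"
    with top_edge_inner[OF e' n v] have "\<Phi> u = d' # a' # b' # p" by blast
    then show False using u btw \<open>strictly_between a' d' b'\<close> by (auto simp: strictly_between_def)
  qed
  ultimately show ?thesis
    using top_edge_not_between[OF e' n v] by (auto simp: strictly_between_def)
qed

lemma top_edge_flip:
  assumes e: "{u, v} \<in> edges G n" and n: "1 < n"
    and u: "\<Phi> u = d # b # a # p" and v: "\<Phi> v = d' # b' # a' # p"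
  shows "b < d \<longleftrightarrow> d' \<le> b'"
proof -
  have V: "u \<in> verts G" using edge_verts[OF e] n by auto
  have len: "length p + 2 = n" using length_label[OF V] u by simp
  show ?thesis
    using top_edge_sig(1)[OF e n, of n] unfolding u v top_sig(1)[OF len] by (auto split: if_splits)
qed

text \<open>If the third largest entries differed, the entry before them could be placed in between, and the
  resulting double edge would fix the largest entry.\<close>

lemma top_edge_outer_third:
  assumes e: "{u, v} \<in> edges G n" and n: "1 < n"
    and u: "\<Phi> u = d # b # a # p" and v: "\<Phi> v = d' # b' # a' # p"
    and btw: "strictly_between b a d"
  shows "a' = a"
proof (rule ccontr)
  assume ne: "a' \<noteq> a"
  have V: "u \<in> verts G" "v \<in> verts G" using edge_verts[OF e] n by auto
  have cw: "cword (d # b # a # p)" "cword (d' # b' # a' # p)"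
    using cword_label[OF V(1)] cword_label[OF V(2)] u v by auto
  have btw': "strictly_between b' a' d'" by (rule top_edge_outer_between[OF e n u v btw])
  obtain g r where g: "strictly_between a g a'" "cword (g # r)" "length (g # r) = length p"
      "shape (g # r) = shape p"
    using cword_addable_removable[of p a a'] cw ne by auto
  obtain u1 v1 where e1: "{u1, v1} \<in> edges G n" 
    and u1: "\<Phi> u1 = d # b # a # g # r" and v1: "\<Phi> v1 = d' # b' # a' # g # r"
    using top_edge_transport[OF e n u v g(2)] g by metis
  have V1: "u1 \<in> verts G" "v1 \<in> verts G" using edge_verts[OF e1] n by auto
  have len: "n = length r + 3" using length_label[OF V(1)] u g(3) by simp
  have flip: "b < d \<longleftrightarrow> d' \<le> b'" by (rule top_edge_flip[OF e n u v])
  \<comment> \<open>Coordinate \<open>n - 2\<close> compares \<open>g\<close> with the third letter,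
    and \<open>g\<close> separates \<open>a\<close> from \<open>a'\<close>. The third axiom turns
    this change of sign into \<open>s\<close>.\<close>
  have "word_sig (\<Phi> u1) (n - 2) \<noteq> word_sig (\<Phi> v1) (n - 2)"
    unfolding u1 v1 using g(1) len by (auto simp: strictly_between_def)
  from top_edge_sig(3)[OF e1 n _ this] have s: "word_sig (\<Phi> u1) (n - 2) = - word_sig (\<Phi> u1) (n - 1)"
    using len by simp
  \<comment> \<open>Coordinates \<open>n - 2\<close> and \<open>n - 1\<close> are opposite at
    \<open>u1\<close>, and both change sign along the edge. So both ends have an edge of color
    \<open>n - 1\<close>.\<close>
  have 1: "word_sig (\<Phi> u1) (n - 2) \<noteq> word_sig (\<Phi> u1) (n - 1)"
    "word_sig (\<Phi> v1) (n - 2) \<noteq> word_sig (\<Phi> v1) (n - 1)"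
    using s g(1) btw btw' flip unfolding u1 v1 len by (auto simp: strictly_between_def split: if_splits)
  then obtain w z where w: "{u1, w} \<in> edges G (n - 1)" "{v1, z} \<in> edges G (n - 1)"
    using edge_iff[OF V1(1), of "n - 1"] edge_iff[OF V1(2), of "n - 1"] len
    by (auto simp: numeral_2_eq_2)
  then have "v1 = w" using two_color_double_edge[OF _ _ e1 w(1)] len by auto
  then have "\<Phi> v1 = word_dual (n - 1) (\<Phi> u1)"
    using low_edge[OF _ _ w(1)] len by simp
  \<comment> \<open>A move of color \<open>n - 1\<close> leaves the head alone. But \<open>s\<close>
    puts \<open>g\<close> on the side of \<open>a\<close> facing \<open>b\<close>, so
    \<open>d'\<close>, \<open>a'\<close>, \<open>g\<close>, \<open>a\<close>, \<open>d\<close> are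
    in strictly monotone order.\<close>
  then have "d = d'" unfolding u1 v1 using len by (simp add: word_dual_Cons)
  then show False
    using g(1) s btw btw' flip unfolding u1 len by (auto simp: strictly_between_def split: if_splits)
qed

text \<open>If the new positions \<open>d\<close> and \<open>b'\<close> differed, a removable \<open>g\<close> between them and a removable \<open>f\<close>
  between \<open>a\<close> and \<open>g\<close> would produce a three-color component excluded by the fourth axiom.\<close>

lemma top_edge_outer_second:
  assumes e: "{u, v} \<in> edges G n" and n: "1 < n"
    and u: "\<Phi> u = d # b # a # p" and v: "\<Phi> v = d' # b' # a # p"
    and btw: "strictly_between b a d"
  shows "b' = d"
proof (rule ccontr)
  assume ne: "b' \<noteq> d"
  have V: "u \<in> verts G" "v \<in> verts G" using edge_verts[OF e] n by auto
  have cw: "cword (d # b # a # p)" "cword (d' # b' # a # p)"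
    using cword_label[OF V(1)] cword_label[OF V(2)] u v by auto
  have orient: "(b < a \<and> a < d \<and> d' < a \<and> a < b') \<or> (d < a \<and> a < b \<and> b' < a \<and> a < d')"
    using btw top_edge_outer_between[OF e n u v btw] top_edge_flip[OF e n u v]
    by (auto simp: strictly_between_def)
  have cwap: "cword (a # p)" "cword p" using cw by auto
  \<comment> \<open>As \<open>a\<close> separates \<open>b\<close> and \<open>d\<close>, these
    letters commute, which makes \<open>d\<close> addable to the same shape as
    \<open>b'\<close>.\<close>
  have "cword (b # d # a # p)"
    using cword_swap(1)[OF cw(1)] orient by auto
  then have add: "addable (shape (a # p)) d" "addable (shape (a # p)) b'" using cw by auto
  obtain g where g: "removable (shape (a # p)) g" "strictly_between d g b'"
    using removable_between_addable[OF add] ne by auto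
  have ag: "a \<noteq> g" using g(2) orient by (auto simp: strictly_between_def)
  have rema: "removable (shape (a # p)) a" by (rule cword_hd_removable[OF cwap(1)])
  have "removable (shape p) g"
    unfolding shape_tl[OF cwap(1)] removable_far[OF removable_gap[OF rema g(1) ag]] by (rule g(1))
  then obtain q where q: "cword (g # q)" "length (g # q) = length p" "shape (g # q) = shape p"
    using cword_removable[OF cwap(2)] by blast
  have sq: "shape q = remove_cell (remove_cell (shape (a # p)) a) g"
    unfolding shape_tl[OF q(1)] q(3) shape_tl[OF cwap(1)] ..
  obtain f where f: "removable (shape q) f" "strictly_between a f g"
    using removable_between_removable[OF rema g(1) ag] unfolding sq by blast
  have "cword q" using q(1) by simp
  then obtain r where r: "cword (f # r)" "length (f # r) = length q" "shape (f # r) = shape q"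
    using cword_removable f(1) by blast
  have gfr: "cword (g # f # r)" "length p = length (g # f # r)" "shape p = shape (g # f # r)"
    using q r by auto
  obtain u1 v1 where e1: "{u1, v1} \<in> edges G n"
    and u1: "\<Phi> u1 = d # b # a # g # f # r" and v1: "\<Phi> v1 = d' # b' # a # g # f # r"
    using top_edge_transport[OF e n u v gfr] by blast
  have V1: "u1 \<in> verts G" "v1 \<in> verts G" using edge_verts[OF e1] n by auto
  have len: "n = length r + 4" using length_label[OF V(1)] u gfr(2) by simp
  have lens: "n - 2 = length r + 2" "n - 1 = length r + 3" using len by auto
  have i2: "1 < n - 2" "n - 2 < n" and i1: "1 < n - 1" "n - 1 < n" "n - 1 \<le> n" "n - 1 - 1 = n - 2"
    and i3: "3 < n"
    using len by auto
  \<comment> \<open>This is what \<open>f\<close> is for: the move of color \<open>n - 2\<close>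
    exchanges \<open>a\<close> and \<open>g\<close> at both ends of the edge.\<close>
  have dual2: "word_dual (n - 2) (x # y # a # g # f # r) = x # y # g # a # f # r" for x y
    unfolding lens using word_dual_top_between[OF f(2), of r] by (simp add: word_dual_Cons)
  have "word_dual (n - 2) (\<Phi> u1) \<noteq> \<Phi> u1" "word_dual (n - 2) (\<Phi> v1) \<noteq> \<Phi> v1"
    unfolding u1 v1 dual2 using ag by auto
  then obtain w1 x1 where w1: "{u1, w1} \<in> edges G (n - 2)" "\<Phi> w1 = d # b # g # a # f # r"
    and x1: "{v1, x1} \<in> edges G (n - 2)" "\<Phi> x1 = d' # b' # g # a # f # r"
    using edge_dual[OF V1(1) i2] edge_dual[OF V1(2) i2] unfolding u1 v1 dual2 by blast
  \<comment> \<open>Seen from \<open>a\<close>, the letters \<open>d\<close>, \<open>b'\<close>,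
    \<open>g\<close> lie on one side and \<open>b\<close>, \<open>d'\<close> on the other. So
    \<open>a\<close> is extreme among \<open>b'\<close>, \<open>a\<close>, \<open>g\<close> but lies
    between \<open>b\<close> and \<open>g\<close>; hence \<open>v1\<close> has an edge of color
    \<open>n - 1\<close> and \<open>u1\<close> has none.\<close>
  have "\<exists>z. {v1, z} \<in> edges G (n - 1)"
    unfolding edge_iff[OF V1(2) i1(1,3)] unfolding i1(4) v1 lens
    using orient g(2) by (auto simp: strictly_between_def)
  then obtain x2 where x2: "{v1, x2} \<in> edges G (n - 1)" ..
  have no: "\<nexists>z. {u1, z} \<in> edges G (n - 1)"
    unfolding edge_iff[OF V1(1) i1(1,3)] unfolding i1(4) u1 lens
    using orient g(2) by (auto simp: strictly_between_def)
  have e1': "{v1, u1} \<in> edges G n" using e1 by (simp add: insert_commute)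
  have alt: "(x1 = x2 \<and> (\<exists>z. {w1, z} \<in> edges G (n - 1) \<and> {w1, z} \<in> edges G n)) \<or> {w1, x1} \<in> edges G n"
    by (rule three_color_square[OF i3 order_refl e1' x1(1) x2 w1(1) no])
  \<comment> \<open>Going away from \<open>b\<close>, the order is either \<open>a\<close>,
    \<open>d\<close>, \<open>g\<close>, \<open>b'\<close> or \<open>a\<close>, \<open>b'\<close>,
    \<open>g\<close>, \<open>d\<close>.\<close>
  have "(strictly_between a d g \<and> strictly_between g d b) \<or> strictly_between a b' g"
    using orient g(2) by (auto simp: strictly_between_def)
  then show False
  proof
    assume dg: "strictly_between a d g \<and> strictly_between g d b"
    show False using alt
    proof
      assume "x1 = x2 \<and> (\<exists>z. {w1, z} \<in> edges G (n - 1) \<and> {w1, z} \<in> edges G n)"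
      then have x1': "\<Phi> x1 = word_dual (n - 1) (d' # b' # a # g # f # r)"
        using low_edge[OF i1(1,2) x2] unfolding v1 by blast
      \<comment> \<open>Here color \<open>n - 1\<close> at \<open>v1\<close> exchanges
        \<open>b'\<close> and \<open>a\<close>, while color \<open>n - 2\<close> exchanges
        \<open>a\<close> and \<open>g\<close>, so the two neighbours cannot coincide.\<close>
      have "strictly_between b' g a" using g(2) orient dg by (auto simp: strictly_between_def)
      from word_dual_top_between[OF this, of "f # r"]
      have A: "word_dual (n - 1) (b' # a # g # f # r) = a # b' # g # f # r"
        unfolding lens by (simp add: numeral_3_eq_3)
      have B: "word_dual (n - 1) (d' # b' # a # g # f # r) = d' # word_dual (n - 1) (b' # a # g # f # r)"
        by (rule word_dual_Cons) (simp add: len)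
      have "d' # b' # g # a # f # r = d' # a # b' # g # f # r"
        using x1' unfolding x1(2) B A .
      then have "b' = a" by blast
      then show False using orient by linarith
    next
      assume "{w1, x1} \<in> edges G n"
      \<comment> \<open>The square would make \<open>w1\<close> an inner end, and its forced
        neighbour does not have the label of \<open>x1\<close>.\<close>
      from top_edge_inner[OF this n w1(2)] dg have "\<Phi> x1 = d # g # b # a # f # r" by blast
      then have "d # g # b # a # f # r = d' # b' # g # a # f # r" unfolding x1(2) ..
      then have "b = g" by blast
      then show False using dg by (auto simp: strictly_between_def)
    qed
  next
    assume bg: "strictly_between a b' g"
    show False using alt
    proof
      assume "x1 = x2 \<and> (\<exists>z. {w1, z} \<in> edges G (n - 1) \<and> {w1, z} \<in> edges G n)"
      then obtain z where z: "{w1, z} \<in> edges G (n - 1)" "{w1, z} \<in> edges G n" by blast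
      \<comment> \<open>The double edge at \<open>w1\<close> would end in a label starting with
        \<open>d # g # b\<close>, where \<open>g\<close> lies between \<open>b\<close> and
        \<open>d\<close>, so no edge of color \<open>n\<close> is possible.\<close>
      have "strictly_between b a g" using bg orient g(2) by (auto simp: strictly_between_def)
      from word_dual_top_between[OF this, of "f # r"]
      have A: "word_dual (n - 1) (b # g # a # f # r) = g # b # a # f # r"
        unfolding lens by (simp add: numeral_3_eq_3)
      have B: "word_dual (n - 1) (d # b # g # a # f # r) = d # word_dual (n - 1) (b # g # a # f # r)"
        by (rule word_dual_Cons) (simp add: len)
      have "\<Phi> z = d # g # b # a # f # r"
        using low_edge[OF i1(1,2) z(1)] unfolding w1(2) B A .
      moreover have "{z, w1} \<in> edges G n" using z(2) by (simp add: insert_commute)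
      ultimately show False
        using top_edge_not_between[OF _ n, of z w1] bg orient g(2) by (auto simp: strictly_between_def)
    next
      assume "{w1, x1} \<in> edges G n"
      then have "{x1, w1} \<in> edges G n" by (simp add: insert_commute)
      \<comment> \<open>In the label of \<open>x1\<close> the letter \<open>b'\<close> lies between
        \<open>g\<close> and \<open>d'\<close>, again ruling out an edge of color
        \<open>n\<close>.\<close>
      from top_edge_not_between[OF this n x1(2)] show False
        using bg orient by (auto simp: strictly_between_def)
    qed
  qed
qed

lemma top_edge_dual:
  assumes e: "{u, v} \<in> edges G n" and n: "1 < n"
  shows "\<Phi> v = word_dual n (\<Phi> u)"
proof -
  have e': "{v, u} \<in> edges G n" using e by (simp add: insert_commute)
  obtain d b a d' b' a' p where u: "\<Phi> u = d # b # a # p" and v: "\<Phi> v = d' # b' # a' # p"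
      and len: "length p + 2 = n" and cw: "cword (d # b # a # p)"
    using top_edge_labels[OF e n] by metis
  have "a \<noteq> d" using cword_distinct3[OF cw] by simp
  then consider "strictly_between a d b" | "strictly_between b a d"
    using top_edge_not_between[OF e n u] unfolding strictly_between_def by linarith
  then show ?thesis
  proof cases
    case 1
    show ?thesis
      unfolding top_edge_inner[OF e n u 1] u len[symmetric]
      using 1 by (auto simp: strictly_between_def)
  next
    case 2
    have a: "a' = a" by (rule top_edge_outer_third[OF e n u v 2])
    \<comment> \<open>\<open>top_edge_outer_second\<close> gives only one of the two new letters;
      the other comes from the reversed edge.\<close>
    have b: "b' = d" by (rule top_edge_outer_second[OF e n u v[unfolded a] 2])
    have "strictly_between b' a d'" using top_edge_outer_between[OF e n u v 2] a by simp
    from top_edge_outer_second[OF e' n v[unfolded a] u this] have "d' = b" by simp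
    then show ?thesis
      unfolding v a b u len[symmetric] using 2 by (auto simp: strictly_between_def)
  qed
qed

lemma edge_word_dual:
  assumes "{u, v} \<in> edges G i" "1 < i" "i \<le> n"
  shows "\<Phi> v = word_dual i (\<Phi> u)"
  using assms low_edge top_edge_dual by (cases "i = n") auto

end

section \<open>Existence and uniqueness of the morphism\<close>

text \<open>The isomorphism gives words of length \<open>n\<close>, and one letter common to the
  whole component is put in front. Moves of color below \<open>n\<close> stay valid, so only
  coordinate \<open>n\<close> has to be matched, by \<open>sign_extension\<close>.\<close>

lemma component_word_labelling:
  assumes scg: "is_scg (n + 1) (n + 1) G" and axs: "scg_axioms (n + 1) (n + 1) G"
    and CV: "C \<subseteq> verts G" "C \<noteq> {}"
    and closed: "\<And>i u v. 1 < i \<Longrightarrow> i < n \<Longrightarrow> {u, v} \<in> edges G i \<Longrightarrow> u \<in> C \<Longrightarrow> v \<in> C"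
    and mu: "partition_of n mu"
    and iso: "scg_iso n n (induced_sub (scg_restrict n n G) C) (Gstd mu) \<phi>"
  shows "\<exists>\<Psi>. (\<forall>v\<in>C. cword (\<Psi> v) \<and> length (\<Psi> v) = n + 1 \<and>
                (\<forall>i. 1 \<le> i \<and> i \<le> n \<longrightarrow> word_sig (\<Psi> v) i = sig G v i)) \<and>
            (\<forall>i u v. 1 < i \<and> i < n \<and> {u, v} \<in> edges G i \<and> u \<in> C \<longrightarrow> \<Psi> v = word_dual i (\<Psi> u))"
proof -
  have sum: "sum_list mu = n" using mu unfolding partition_of_def by simp
  have bij: "bij_betw \<phi> C (SYT mu)"
    using iso unfolding scg_iso_def induced_sub_def Gstd_def by simp
  have SYT: "\<phi> v \<in> SYT mu" if "v \<in> C" for v using bij that unfolding bij_betw_def by blast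
  define W where "W = (\<lambda>v. tab_word mu (\<phi> v) n)"
  have W: "cword (W v)" "length (W v) = n" "shape (W v) = maya (row_len mu)" if "v \<in> C" for v
    using tab_word_cword[OF mu SYT[OF that], of n] shape_tab_word[OF mu SYT[OF that]]
    unfolding W_def by (auto simp: tab_word_def)
  have W_sig: "word_sig (W v) i = sig G v i" if "v \<in> C" "1 \<le> i" "i < n" for v i
  proof -
    have "dsig mu (\<phi> v) i = sig G v i"
      using iso that unfolding scg_iso_def scg_morphism_def sc_def Gstd_def induced_sub_def scg_restrict_def
      by simp
    then show ?thesis using word_sig_tab_word[OF mu SYT[OF that(1)] that(2,3)] unfolding W_def by simp
  qed
  have W_edge: "W v = word_dual i (W u)" if i: "1 < i" "i < n" and e: "{u, v} \<in> edges G i" and u: "u \<in> C" for i u v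
  proof -
    have "v \<in> C" by (rule closed[OF i e u])
    then have "{\<phi> u, \<phi> v} \<in> edges (Gstd mu) i"
      using iso i e u unfolding scg_iso_def scg_morphism_def induced_sub_def scg_restrict_def by simp
    then show ?thesis unfolding W_def by (rule Gstd_edge_tab_word[OF mu i])
  qed
  have W_inj: "u = v" if "u \<in> C" "v \<in> C" "W u = W v" for u v
  proof -
    have "\<phi> u = \<phi> v"
      using tab_word_inj(2)[OF mu SYT[OF that(1)] mu SYT[OF that(2)]] that(3) unfolding W_def .
    then show ?thesis using bij that unfolding bij_betw_def inj_on_def by blast
  qed
  obtain v0 where v0: "v0 \<in> C" using CV by blast
  have W_surj: "\<exists>v\<in>C. W v = w" if w: "cword w" "length w = n" "shape w = shape (W v0)" for w
  proof -
    obtain S where S: "S \<in> SYT mu" "tab_word mu S n = w"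
      using tab_word_same_shape[OF mu SYT[OF v0] w(1,2)] w(3) unfolding W_def by blast
    have "S \<in> \<phi> ` C" using bij S(1) unfolding bij_betw_def by simp
    then obtain v where "v \<in> C" "S = \<phi> v" ..
    then show ?thesis using S(2) unfolding W_def by auto
  qed
  have edge_ex: "\<exists>x. {v, x} \<in> edges G i \<and> x \<in> C \<and> W x = word_dual i (W v)"
    if v: "v \<in> C" and i: "1 < i" "i < n" and ne: "word_dual i (W v) \<noteq> W v" for v i
  proof -
    have "word_sig (W v) (i - 1) \<noteq> word_sig (W v) i"
      using word_dual_fixed_iff[OF W(1)[OF v] i(1)] W(2)[OF v] i ne by simp
    moreover have "word_sig (W v) (i - 1) = sig G v (i - 1)" "word_sig (W v) i = sig G v i"
      using W_sig[OF v] i by auto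
    moreover have "word_sig (W v) (i - 1) \<in> {1, -1}" "word_sig (W v) i \<in> {1, -1}"
      using word_sig_range[of "i - 1" "W v"] word_sig_range[of i "W v"] W(2)[OF v] i by auto
    ultimately have s: "sig G v (i - 1) = - sig G v i" by auto
    have "ax1 (n + 1) (n + 1) G" using axs unfolding scg_axioms_def by blast
    moreover have "1 < i \<and> i < n + 1" "sc (n + 1) (i - 1) \<and> sc (n + 1) i"
      using i by (auto simp: sc_def)
    ultimately obtain x where "{v, x} \<in> edges G i" using s v CV unfolding ax1_def by blast
    then show ?thesis using closed[OF i _ v] W_edge[OF i _ v] by blast
  qed
  have "\<exists>c. addable (shape (W v0)) c \<and> (0 < n \<longrightarrow> (\<forall>v\<in>C. sig G v n = 1 \<longleftrightarrow> hd (W v) < c))"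
  proof (cases "0 < n")
    case False
    then have "W v0 = []" using W(2)[OF v0] by simp
    \<comment> \<open>For \<open>n = 0\<close> the empty shape has only the cell of content 0 to
      offer, and there is no sign to match.\<close>
    then show ?thesis using False by (intro exI[of _ 0]) (auto simp: addable_def)
  next
    case n: True
    \<comment> \<open>\<open>W\<close> is a bijection from the component onto the words of one
      shape, which makes coordinate \<open>n\<close> a function of words.\<close>
    define \<tau> where "\<tau> = (\<lambda>w. sig G (THE v. v \<in> C \<and> W v = w) n)"
    have \<tau>: "\<tau> (W v) = sig G v n" if "v \<in> C" for v
    proof -
      have "(THE u. u \<in> C \<and> W u = W v) = v" using that W_inj by blast
      then show ?thesis unfolding \<tau>_def by simp
    qed
    have shape_eq: "shape (W v) = shape (W v0)" if "v \<in> C" for v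
      using W(3)[OF that] W(3)[OF v0] by simp
    have sig_n: "sig G v n \<in> {1, -1}" if "v \<in> C" for v
      using scg_sig_range[OF scg, of v n] that CV n by auto
    have ax2: "ax2 (n + 1) (n + 1) G" and ax3: "ax3 (n + 1) (n + 1) G"
      using axs unfolding scg_axioms_def by auto
    have "\<exists>c. addable (shape (W v0)) c \<and>
           (\<forall>a p. cword (a # p) \<longrightarrow> length (a # p) = n \<longrightarrow> shape (a # p) = shape (W v0) \<longrightarrow>
              (\<tau> (a # p) = 1 \<longleftrightarrow> a < c))"
    proof (rule sign_extension[OF W(1,2)[OF v0] n])
      fix w assume w: "cword w" "length w = n" "shape w = shape (W v0)"
      obtain v where v: "v \<in> C" "W v = w" using W_surj[OF w] by blast
      show "\<tau> w \<in> {1, -1}" using \<tau>[OF v(1)] sig_n[OF v(1)] v(2) by simp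
      show "\<tau> (word_dual i w) = \<tau> w" if i: "1 < i" "i + 1 < n" for i
      proof (cases "word_dual i w = w")
        case False
        then obtain x where x: "{v, x} \<in> edges G i" "x \<in> C" "W x = word_dual i w"
          using edge_ex[OF v(1), of i] i v(2) by auto
        have "1 < i \<and> i < n + 1" "sc (n + 1) n \<and> (n + 2 < i \<or> n > i + 1)"
          using i by (auto simp: sc_def)
        then have "sig G v n = sig G x n" using ax2 x(1) unfolding ax2_def by blast
        then show ?thesis using \<tau>[OF v(1)] \<tau>[OF x(2)] x(3) v(2) by simp
      qed simp
      \<comment> \<open>Color \<open>n - 1\<close> is the only one below \<open>n\<close> whose
        edges may change coordinate \<open>n\<close>; there the third axiom takes over from the
        second.\<close>
      assume n2: "2 < n" and ne: "word_dual (n - 1) w \<noteq> w" and differ: "\<tau> (word_dual (n - 1) w) \<noteq> \<tau> w"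
      have i: "1 < n - 1" "n - 1 < n" using n2 by arith+
      obtain x where x: "{v, x} \<in> edges G (n - 1)" "x \<in> C" "W x = word_dual (n - 1) w"
        using edge_ex[OF v(1) i] ne v(2) by auto
      have "sig G v n = - sig G x n"
        using differ \<tau>[OF v(1)] \<tau>[OF x(2)] x(3) v(2) sig_n[OF v(1)] sig_n[OF x(2)] by auto
      moreover have "1 < n - 1 \<and> n - 1 < n + 1" "sc (n + 1) (n - 1 + 1)" "sc (n + 1) (n - 1)" "n - 1 + 1 = n"
        using n2 by (auto simp: sc_def)
      ultimately have "sig G v n = - sig G v (n - 1)"
        using ax3 x(1) unfolding ax3_def by metis
      moreover have "word_sig w (n - 1) = sig G v (n - 1)" using W_sig[OF v(1), of "n - 1"] i v(2) by simp
      moreover have "sig G v n = \<tau> w" using \<tau>[OF v(1)] v(2) by simp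
      ultimately show "\<tau> w \<noteq> word_sig w (n - 1)" using sig_n[OF v(1)] by auto
    qed
    then obtain c where c: "addable (shape (W v0)) c"
      "\<And>a p. cword (a # p) \<Longrightarrow> length (a # p) = n \<Longrightarrow> shape (a # p) = shape (W v0) \<Longrightarrow> 
              (\<tau> (a # p) = 1 \<longleftrightarrow> a < c)" by blast
    have "sig G v n = 1 \<longleftrightarrow> hd (W v) < c" if v: "v \<in> C" for v
    proof -
      obtain a p where ap: "W v = a # p" using W(2)[OF v] n by (cases "W v") auto
      then show ?thesis using c(2)[of a p] W(1,2)[OF v] shape_eq[OF v] \<tau>[OF v] by simp
    qed
    then show ?thesis using c(1) by blast
  qed
  then obtain c where c: "addable (shape (W v0)) c"
     "\<And>v. 0 < n \<Longrightarrow> v \<in> C \<Longrightarrow> sig G v n = 1 \<longleftrightarrow> hd (W v) < c" by blast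
  define \<Psi> where "\<Psi> = (\<lambda>v. c # W v)"
  have "cword (\<Psi> v) \<and> length (\<Psi> v) = n + 1" if v: "v \<in> C" for v
    using W[OF v] W(3)[OF v0] c(1) unfolding \<Psi>_def by simp
  moreover have "word_sig (\<Psi> v) i = sig G v i" if v: "v \<in> C" and i: "1 \<le> i" "i \<le> n" for v i
  proof (cases "i < n")
    case True
    then show ?thesis using W_sig[OF v i(1)] W(2)[OF v] unfolding \<Psi>_def by (simp add: word_sig_Cons)
  next
    case False
    then have n: "i = n" "0 < n" using i by auto
    obtain a p where ap: "W v = a # p" using W(2)[OF v] n by (cases "W v") auto
    have "length p + 1 = n" using W(2)[OF v] ap by simp
    moreover have "sig G v n \<in> {1, -1}"
      using scg_sig_range[OF scg, of v n] v CV n by auto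
    ultimately show ?thesis using c(2)[OF n(2) v] n unfolding \<Psi>_def ap by auto
  qed
  moreover have "\<Psi> v = word_dual i (\<Psi> u)" if "1 < i" "i < n" "{u, v} \<in> edges G i" "u \<in> C" for i u v
    using W_edge[OF that] W(2)[OF that(4)] that(2) unfolding \<Psi>_def by (simp add: word_dual_Cons)
  ultimately show ?thesis by blast
qed

section \<open>Uniqueness and existence for the whole graph\<close>

text \<open>The two images of a vertex have equal signatures. Where a move is nontrivial, the first
  axiom supplies an edge of \<open>G\<close> that both morphisms map to this move. So the words are
  bisimilar, hence equal, and a word determines its partition.\<close>

lemma morphism_unique_partition:
  assumes scg: "is_scg N N G" and ax1: "ax1 N N G" and ne: "verts G \<noteq> {}"
    and lam: "partition_of N lam" "scg_morphism N N G (Gstd lam) \<phi>"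
    and lam': "partition_of N lam'" "scg_morphism N N G (Gstd lam') \<phi>'"
  shows "lam = lam'"
proof -
  define R where "R = (\<lambda>p q. \<exists>v\<in>verts G. p = tab_word lam (\<phi> v) N \<and> q = tab_word lam' (\<phi>' v) N)"
  have SYT: "\<phi> v \<in> SYT lam" "\<phi>' v \<in> SYT lam'" if "v \<in> verts G" for v
    using lam(2) lam'(2) that unfolding scg_morphism_def Gstd_def by auto
  have sig: "word_sig (tab_word lam (\<phi> v) N) i = sig G v i" "word_sig (tab_word lam' (\<phi>' v) N) i = sig G v i"
    if v: "v \<in> verts G" and i: "1 \<le> i" "i < N" for v i
    using word_sig_tab_word[OF lam(1) SYT(1)[OF v] i] word_sig_tab_word[OF lam'(1) SYT(2)[OF v] i]
      lam(2) lam'(2) v i unfolding scg_morphism_def Gstd_def sc_def by auto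
  have cw: "cword (tab_word lam (\<phi> v) N)" "cword (tab_word lam' (\<phi>' v) N)" if v: "v \<in> verts G" for v
    using tab_word_cword[OF lam(1) SYT(1)[OF v]] tab_word_cword[OF lam'(1) SYT(2)[OF v]] by auto
  have len: "length (tab_word mu T N) = N" for mu T by (simp add: tab_word_def)
  obtain v0 where v0: "v0 \<in> verts G" using ne by blast
  have "tab_word lam (\<phi> v0) N = tab_word lam' (\<phi>' v0) N"
  proof (rule bisimilar_words_equal[of R N])
    fix p q assume "R p q"
    then obtain v where v: "v \<in> verts G" and
      p: "p = tab_word lam (\<phi> v) N" and q: "q = tab_word lam' (\<phi>' v) N" unfolding R_def by blast
    show "cword p \<and> cword q \<and> length p = N \<and> length q = N"
      unfolding p q len using cw[OF v] by simp
    show "word_sig p i = word_sig q i" if "1 \<le> i" "i < N" for i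
      unfolding p q sig[OF v that] ..
    show "R (word_dual i p) (word_dual i q)" if i: "1 < i" "i < N" for i
    proof (cases "sig G v (i - 1) = sig G v i")
      case True
      have "word_dual i p = p" "word_dual i q = q"
        using word_dual_fixed_iff[OF cw(1)[OF v] i(1)] word_dual_fixed_iff[OF cw(2)[OF v] i(1)]
          sig[OF v, of i] sig[OF v, of "i - 1"] i True unfolding p q len by auto
      then show ?thesis using \<open>R p q\<close> by simp
    next
      case False
      have "sig G v (i - 1) \<in> {1, -1}" "sig G v i \<in> {1, -1}"
        using scg_sig_range[OF scg v, of "i - 1"] scg_sig_range[OF scg v, of i] i by auto
      then have s: "sig G v (i - 1) = - sig G v i" using False by auto
      have "1 < i \<and> i < N" "sc N (i - 1) \<and> sc N i" using i by (auto simp: sc_def)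
      then obtain x where x: "{v, x} \<in> edges G i" using ax1 s v unfolding ax1_def by blast
      have e: "{\<phi> v, \<phi> x} \<in> edges (Gstd lam) i" "{\<phi>' v, \<phi>' x} \<in> edges (Gstd lam') i"
        using lam(2) lam'(2) x i unfolding scg_morphism_def by auto
      show ?thesis
        unfolding R_def p q
          Gstd_edge_tab_word[OF lam(1) i e(1), symmetric] Gstd_edge_tab_word[OF lam'(1) i e(2), symmetric]
        using scg_edge_verts(2)[OF scg i x] by blast
    qed
  next
    show "R (tab_word lam (\<phi> v0) N) (tab_word lam' (\<phi>' v0) N)" unfolding R_def using v0 by blast
  qed
  then show ?thesis by (rule tab_word_inj(1)[OF lam(1) SYT(1)[OF v0] lam'(1) SYT(2)[OF v0]])
qed

text \<open>Once all edges act as dual moves, which preserve shapes, connectivity makes the shape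
  constant. A tableau for one label fixes the partition, and every other label is then the word of a
  tableau of it.\<close>

lemma (in word_labelled_graph) morphism_exists:
  assumes conn: "scg_connected (n + 1) G"
  shows "\<exists>lam \<phi>. partition_of (n + 1) lam \<and> scg_morphism (n + 1) (n + 1) G (Gstd lam) \<phi>"
proof -
  obtain v0 where v0: "v0 \<in> verts G" using conn unfolding scg_connected_def by blast
  obtain lam T where lam: "partition_of (n + 1) lam" and T: "T \<in> SYT lam" and w0: "tab_word lam T (n + 1) = \<Phi> v0"
    using tab_word_exists[OF cword_label[OF v0]] length_label[OF v0] by auto
  have shape_const: "shape (\<Phi> v) = shape (\<Phi> v0)" if v: "v \<in> verts G" for v
  proof -
    have "(v0, v) \<in> (col_rel G (colors (n + 1)))\<^sup>*" using conn v v0 unfolding scg_connected_def by blast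
    then show ?thesis
    proof (induction rule: rtrancl_induct)
      case base then show ?case by simp
    next
      case (step y z)
      then obtain i where i: "1 < i" "i \<le> n" "{y, z} \<in> edges G i"
        unfolding col_rel_def colors_def by auto
      have "\<Phi> z = word_dual i (\<Phi> y)" by (rule edge_word_dual[OF i(3,1,2)])
      moreover have "cword (\<Phi> y)" using cword_label edge_verts(1)[OF i(3,1,2)] by blast
      ultimately show ?case using cword_word_dual[of "\<Phi> y" i] step.IH by simp
    qed
  qed
  have "\<exists>S\<in>SYT lam. tab_word lam S (n + 1) = \<Phi> v" if v: "v \<in> verts G" for v
    using tab_word_same_shape[OF lam T cword_label[OF v] length_label[OF v]] shape_const[OF v]
    unfolding w0 by blast
  then obtain \<phi> where \<phi>: "\<And>v. v \<in> verts G \<Longrightarrow> \<phi> v \<in> SYT lam \<and> tab_word lam (\<phi> v) (n + 1) = \<Phi> v"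
    by metis
  have "scg_morphism (n + 1) (n + 1) G (Gstd lam) \<phi>"
    unfolding scg_morphism_def
  proof (intro conjI ballI allI impI)
    fix v assume v: "v \<in> verts G"
    show "\<phi> v \<in> verts (Gstd lam)" using \<phi>[OF v] by (simp add: Gstd_def)
    fix j assume j: "sc (n + 1) j"
    show "sig (Gstd lam) (\<phi> v) j = sig G v j"
      using word_sig_tab_word[OF lam, of "\<phi> v" j] \<phi>[OF v] sig_label[OF v, of j] j
      by (simp add: Gstd_def sc_def)
  next
    fix i u v assume i: "1 < i \<and> i < n + 1" and e: "{u, v} \<in> edges G i"
    then have i': "1 < i" "i \<le> n" by auto
    note V = edge_verts[OF e i']
    have d: "\<Phi> v = word_dual i (\<Phi> u)" by (rule edge_word_dual[OF e i'])
    \<comment> \<open>Edges of the standard graph join different tableaux, so the move must be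
      nontrivial; the first axiom says so through the signature.\<close>
    have "word_dual i (\<Phi> u) \<noteq> \<Phi> u"
      using word_dual_fixed_iff[OF cword_label[OF V(1)] i'(1)] length_label[OF V(1)] i
        edge_iff[OF V(1) i'] e by auto
    then show "{\<phi> u, \<phi> v} \<in> edges (Gstd lam) i"
      using Gstd_edgeI[OF lam _ _ conjunct1[OF \<phi>[OF V(1)]] conjunct1[OF \<phi>[OF V(2)]]] \<phi>[OF V(1)] \<phi>[OF V(2)] d i
      by simp
  qed
  with lam show ?thesis by blast
qed

theorem theorem3p10:
  fixes G :: "'v scg" and n :: nat
  assumes "is_scg (n + 1) (n + 1) G"
    and "scg_connected (n + 1) G"
    and "scg_axioms (n + 1) (n + 1) G"
    and "\<forall>C \<in> scg_components n (scg_restrict n n G).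
           \<exists>mu. partition_of n mu \<and>
             (\<exists>\<phi>. scg_iso n n (induced_sub (scg_restrict n n G) C) (Gstd mu) \<phi>)"
  shows "\<exists>!lam. partition_of (n + 1) lam \<and>
           (\<exists>\<phi>. scg_morphism (n + 1) (n + 1) G (Gstd lam) \<phi>)"
proof -
  let ?H = "scg_restrict n n G"
  let ?C = "col_comp ?H (colors n)"
  have self: "v \<in> ?C v" for v by (rule component_self)
  have edge_H: "{u, v} \<in> edges ?H i \<longleftrightarrow> {u, v} \<in> edges G i" if "1 < i" "i < n" for u v i
    using that by (simp add: scg_restrict_def)
  have closed: "v \<in> ?C w" if "1 < i" "i < n" "{u, v} \<in> edges G i" "u \<in> ?C w" for i u v w
    using component_edge[of u v ?H i "colors n" w] edge_H that by (simp add: colors_def)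
  have sub: "?C w \<subseteq> verts G" if w: "w \<in> verts G" for w
  proof
    fix v assume "v \<in> ?C w"
    then have "(w, v) \<in> (col_rel ?H (colors n))\<^sup>*" unfolding col_comp_def by simp
    then show "v \<in> verts G"
    proof (induction rule: rtrancl_induct)
      case base then show ?case by (rule w)
    next
      case (step y z)
      then obtain i where "1 < i" "i < n" "{y, z} \<in> edges G i"
        using edge_H unfolding col_rel_def colors_def by blast
      then show ?case using scg_edge_verts(2)[OF assms(1), of i y z] by simp
    qed
  qed
  let ?P = "\<lambda>C \<Psi>. (\<forall>v\<in>C. cword (\<Psi> v) \<and> length (\<Psi> v) = n + 1 \<and>
                (\<forall>i. 1 \<le> i \<and> i \<le> n \<longrightarrow> word_sig (\<Psi> v) i = sig G v i)) \<and>
            (\<forall>i u v. 1 < i \<and> i < n \<and> {u, v} \<in> edges G i \<and> u \<in> C \<longrightarrow> \<Psi> v = word_dual i (\<Psi> u))"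
  have "\<exists>\<Psi>. ?P (?C w) \<Psi>" if w: "w \<in> verts G" for w
  proof -
    have "?C w \<in> scg_components n ?H"
      using w unfolding scg_components_def by (auto simp: scg_restrict_def)
    then obtain mu \<phi> where mu: "partition_of n mu" "scg_iso n n (induced_sub ?H (?C w)) (Gstd mu) \<phi>"
      using assms(4) by blast
    have "?C w \<noteq> {}" using self by fast
    then show ?thesis
      by (rule component_word_labelling[OF assms(1,3) sub[OF w] _ _ mu]) (erule (3) closed)
  qed
  \<comment> \<open>The choice is made per component and not per vertex, so that the two ends of an
    edge of color below \<open>n\<close> use the same labelling.\<close>
  then have "\<forall>C\<in>?C ` verts G. \<exists>\<Psi>. ?P C \<Psi>" by blast
  then obtain \<Psi> where \<Psi>: "\<forall>C\<in>?C ` verts G. ?P C (\<Psi> C)" by (rule bchoice[THEN exE])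
  interpret word_labelled_graph G n "\<lambda>v. \<Psi> (?C v) v"
  proof
    show "is_scg (n + 1) (n + 1) G" "scg_axioms (n + 1) (n + 1) G" by (fact assms)+
    fix v assume v: "v \<in> verts G"
    then have P: "?P (?C v) (\<Psi> (?C v))" using \<Psi> by blast
    then show "cword (\<Psi> (?C v) v)" "length (\<Psi> (?C v) v) = n + 1" using self by blast+
    show "word_sig (\<Psi> (?C v) v) i = sig G v i" if "1 \<le> i" "i \<le> n" for i
      using P self that by blast
  next
    fix i u v assume i: "1 < i" "i < n" and e: "{u, v} \<in> edges G i"
    have "u \<in> verts G" using scg_edge_verts(1)[OF assms(1) i(1) _ e] i by simp
    then have "?P (?C u) (\<Psi> (?C u))" using \<Psi> by blast
    then have "\<Psi> (?C u) v = word_dual i (\<Psi> (?C u) u)" using i e self by blast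
    moreover have "?C v = ?C u" using closed[OF i e self] by (rule col_comp_eq)
    ultimately show "\<Psi> (?C v) v = word_dual i (\<Psi> (?C u) u)" by simp
  qed
  have ax1: "ax1 (n + 1) (n + 1) G" using assms(3) unfolding scg_axioms_def by blast
  have ne: "verts G \<noteq> {}" using assms(2) unfolding scg_connected_def by blast
  show ?thesis
  proof (rule ex_ex1I)
    show "\<exists>lam. partition_of (n + 1) lam \<and> (\<exists>\<phi>. scg_morphism (n + 1) (n + 1) G (Gstd lam) \<phi>)"
      using morphism_exists[OF assms(2)] by blast
  next
    fix lam lam'
    assume "partition_of (n + 1) lam \<and> (\<exists>\<phi>. scg_morphism (n + 1) (n + 1) G (Gstd lam) \<phi>)"
      "partition_of (n + 1) lam' \<and> (\<exists>\<phi>. scg_morphism (n + 1) (n + 1) G (Gstd lam') \<phi>)"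
    then show "lam = lam'" using morphism_unique_partition[OF assms(1) ax1 ne] by blast
  qed
qed

end
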